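(* Let $\Lambda=\{\lambda_j:j\in\mathbb Z\}$ and $M=\{\mu_j:j\in\mathbb Z\}$ be discrete subsets of $\mathbb R$ with strictly increasing enumerations that decompose $\mathbb R$ into the intervals $(\lambda_j,\lambda_{j+1})$ and $(\mu_j,\mu_{j+1})$, $j\in\mathbb Z$, respectively. Suppose that at least one of the following conditions holds: 1. $(\Lambda,M)$ is uniformly supercritical, i.e. $$\sup_{j\in\mathbb Z}\max\{|\lambda_j|,|\lambda_{j+1}|\}(\lambda_{j+1}-\lambda_j)<\pi\quad\text{and}\quad \sup_{j\in\mathbb Z}\max\{|\mu_j|,|\mu_{j+1}|\}(\mu_{j+1}-\mu_j)<\pi;$$ 2. $(\Lambda,M)$ has uniformly supercritical ground-state energy, i.e. $$\inf_{j\in\mathbb Z}\frac{\sqrt{E^{(0)}_{[\lambda_j,\lambda_{j+1}]}}}{\max\{|\lambda_j|,|\lambda_{j+1}|\}}>1\quad\text{and}\quad \inf_{j\in\mathbb Z}\frac{\sqrt{E^{(0)}_{[\mu_j,\mu_{j+1}]}}}{\max\{|\mu_j|,|\mu_{j+1}|\}}>1;$$ 3. $(\Lambda,M)$ has uniformly supercritical Sturm-Liouville spectrum, i.e. $$\inf_{j\in\mathbb Z}\frac{\sqrt{\nu_{[\lambda_j,\lambda_{j+1}]}}}{\max\{|\lambda_j|,|\lambda_{j+1}|\}}>1\quad\text{and}\quad \inf_{j\in\mathbb Z}\frac{\sqrt{\nu_{[\mu_j,\mu_{j+1}]}}}{\max\{|\mu_j|,|\mu_{j+1}|\}}>1.$$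 Then the only function $f\in\mathcal H$ satisfying $f(\lambda_i)=0$ and $\widehat f(\mu_i)=0$ for all $i\in\mathbb Z$ is $f=0$.
   Context: The Fourier transform is the unitary one on $L^2(\mathbb R)$: $\widehat f(k)=\frac1{\sqrt{2\pi}}\int_{\mathbb R}f(x)e^{-ikx}\,dx$ (defined on Schwartz functions and extended unitarily to $L^2(\mathbb R)$). The Fourier-symmetric Sobolev space is $$\mathcal H=\Big\{f\in L^2(\mathbb R):\ \int_{\mathbb R}x^2|f(x)|^2\,dx+\int_{\mathbb R}k^2|\widehat f(k)|^2\,dk<\infty\Big\}.$$ For $f\in\mathcal H$, both $f$ and $\widehat f$ have continuous representatives (their weak derivatives are in $L^2(\mathbb R)$), and pointwise values refer to these representatives. That the enumerations decompose $\mathbb R$ means that $\lambda_j,\mu_j\to\pm\infty$ as $j\to\pm\infty$, so that the intervals cover $\mathbb R$ up to the points of $\Lambda$, respectively $M$. For a bounded interval $[a,b]$, let $H_0^1(a,b)$ be the space of square-integrable functions on $(a,b)$ with square-integrable weak derivative and vanishing boundary values at $a$ and $b$. Then $$E^{(0)}_{[a,b]}=\inf_{0\ne g\in H_0^1(a,b)}\frac{\frac12\int_a^b\big(|g'(x)|^2+x^2|g(x)|^2\big)dx}{\int_a^b|g(x)|^2dx}$$ is the ground-state energy (lowest eigenvalue) of the harmonic oscillator $\frac12(-\frac{d^2}{dx^2}+x^2)$ confined to $[a,b]$ with Dirichlet boundary conditions, and $$\nu_{[a,b]}=\inf_{0\ne g\in H_0^1(a,b)}\frac{\int_a^b|g'(x)|^2dx}{\int_a^b|g(x)|^2dx}$$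 is the lowest eigenvalue of $-g''=\nu g$, $g(a)=g(b)=0$. *)

theory Defs
  imports "HOL-Analysis.Analysis"
begin

section \<open>Square-integrable functions and the Fourier transform\<close>

text \<open>
  Elements of \<open>L\<^sup>2(S)\<close> are given by Borel representatives; equality of elements is equality almost
  everywhere on \<open>S\<close>.
\<close>

definition L2_on :: "real set \<Rightarrow> (real \<Rightarrow> complex) set" where
  "L2_on S = {f. set_borel_measurable lborel S f \<and> set_integrable lborel S (\<lambda>x. (cmod (f x))\<^sup>2)}"

definition vderiv :: "(real \<Rightarrow> complex) \<Rightarrow> real \<Rightarrow> complex" where
  "vderiv f x = vector_derivative f (at x)"

definition smooth :: "(real \<Rightarrow> complex) \<Rightarrow> bool" where
  "smooth f \<longleftrightarrow> (\<forall>n x. (vderiv ^^ n) f differentiable at x)"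

definition schwartz :: "(real \<Rightarrow> complex) \<Rightarrow> bool" where
  "schwartz f \<longleftrightarrow> smooth f \<and> (\<forall>m n. bounded (range (\<lambda>x. x ^ m *\<^sub>R (vderiv ^^ n) f x)))"

definition fourier_integral :: "(real \<Rightarrow> complex) \<Rightarrow> real \<Rightarrow> complex" where
  "fourier_integral f k =
     complex_of_real (1 / sqrt (2 * pi)) *
     (\<integral>x. f x * exp (- (\<i> * complex_of_real k * complex_of_real x)) \<partial>lborel)"

definition L2_tendsto :: "(nat \<Rightarrow> real \<Rightarrow> complex) \<Rightarrow> (real \<Rightarrow> complex) \<Rightarrow> bool" where
  "L2_tendsto \<phi> f \<longleftrightarrow> (\<lambda>n. \<integral>\<^sup>+x. ennreal ((cmod (\<phi> n x - f x))\<^sup>2) \<partial>lborel) \<longlonglongrightarrow> 0"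

text \<open>
  The graph of the unitary Fourier transform on \<open>L\<^sup>2(\<real>)\<close>, i.e. of the continuous extension of
  \<^const>\<open>fourier_integral\<close> from the Schwartz functions. It is a relation because \<open>g\<close> is determined
  by \<open>f\<close> only almost everywhere.
\<close>

definition has_fourier_transform :: "(real \<Rightarrow> complex) \<Rightarrow> (real \<Rightarrow> complex) \<Rightarrow> bool" where
  "has_fourier_transform f g \<longleftrightarrow>
     f \<in> L2_on UNIV \<and> g \<in> L2_on UNIV \<and>
     (\<exists>\<phi>. (\<forall>n. schwartz (\<phi> n)) \<and> L2_tendsto \<phi> f \<and> L2_tendsto (\<lambda>n. fourier_integral (\<phi> n)) g)"

text \<open>
  The Fourier-symmetric Sobolev space. The choice of the representative \<open>g\<close> of the Fourier
  transform of \<open>f\<close> does not matter.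
\<close>

definition fourier_sobolev :: "(real \<Rightarrow> complex) set" where
  "fourier_sobolev =
     {f \<in> L2_on UNIV. \<exists>g. has_fourier_transform f g \<and>
        (\<integral>\<^sup>+x. ennreal (x\<^sup>2 * (cmod (f x))\<^sup>2) \<partial>lborel) +
        (\<integral>\<^sup>+k. ennreal (k\<^sup>2 * (cmod (g k))\<^sup>2) \<partial>lborel) < \<infinity>}"

text \<open>Pointwise values of an element of \<open>L\<^sup>2(\<real>)\<close> are those of its (unique) continuous representative.\<close>

definition vanishes_on :: "(real \<Rightarrow> complex) \<Rightarrow> real set \<Rightarrow> bool" where
  "vanishes_on f A \<longleftrightarrow>
     (\<exists>f0. continuous_on UNIV f0 \<and> (AE x in lborel. f x = f0 x) \<and> (\<forall>a\<in>A. f0 a = 0))"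


section \<open>Dirichlet eigenvalues on a bounded interval\<close>

definition test_functions :: "real \<Rightarrow> real \<Rightarrow> (real \<Rightarrow> complex) set" where
  "test_functions a b =
     {\<phi>. smooth \<phi> \<and> (\<exists>c d. a < c \<and> d < b \<and> (\<forall>x. x \<notin> {c..d} \<longrightarrow> \<phi> x = 0))}"

definition has_weak_derivative ::
    "(real \<Rightarrow> complex) \<Rightarrow> (real \<Rightarrow> complex) \<Rightarrow> real \<Rightarrow> real \<Rightarrow> bool" where
  "has_weak_derivative g g' a b \<longleftrightarrow>
     (\<forall>\<phi>\<in>test_functions a b.
        (LBINT x:{a<..<b}. g x * vderiv \<phi> x) = - (LBINT x:{a<..<b}. g' x * \<phi> x))"

text \<open>
  \<open>H01 a b\<close> is the set of pairs of an element \<open>g\<close> of \<open>H\<^sub>0\<^sup>1(a,b)\<close> and its weak derivative \<open>g'\<close>.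
  Boundary values are those of the representative of \<open>g\<close> that is continuous on \<open>[a,b]\<close>.
\<close>

definition H01 :: "real \<Rightarrow> real \<Rightarrow> ((real \<Rightarrow> complex) \<times> (real \<Rightarrow> complex)) set" where
  "H01 a b =
     {(g, g'). g \<in> L2_on {a<..<b} \<and> g' \<in> L2_on {a<..<b} \<and> has_weak_derivative g g' a b \<and>
        (\<exists>g0. continuous_on {a..b} g0 \<and> (AE x\<in>{a<..<b} in lborel. g x = g0 x) \<and>
              g0 a = 0 \<and> g0 b = 0)}"

definition ground_state_energy :: "real \<Rightarrow> real \<Rightarrow> real" where
  "ground_state_energy a b =
     Inf {(1/2 * (LBINT x:{a<..<b}. (cmod (g' x))\<^sup>2 + x\<^sup>2 * (cmod (g x))\<^sup>2)) /
            (LBINT x:{a<..<b}. (cmod (g x))\<^sup>2)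
          | g g'. (g, g') \<in> H01 a b \<and> \<not> (AE x\<in>{a<..<b} in lborel. g x = 0)}"

definition sturm_liouville_eigenvalue :: "real \<Rightarrow> real \<Rightarrow> real" where
  "sturm_liouville_eigenvalue a b =
     Inf {(LBINT x:{a<..<b}. (cmod (g' x))\<^sup>2) / (LBINT x:{a<..<b}. (cmod (g x))\<^sup>2)
          | g g'. (g, g') \<in> H01 a b \<and> \<not> (AE x\<in>{a<..<b} in lborel. g x = 0)}"


section \<open>Supercriticality conditions\<close>

text \<open>
  Suprema and infima over \<open>j\<close> are taken in \<^typ>\<open>ereal\<close>, since \<^const>\<open>Sup\<close> of an
  unbounded set of reals is meaningless.
\<close>

definition decomposes_line :: "(int \<Rightarrow> real) \<Rightarrow> bool" where
  "decomposes_line s \<longleftrightarrow>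
     strict_mono s \<and> filterlim s at_top at_top \<and> filterlim s at_bot at_bot"

definition max_abs :: "(int \<Rightarrow> real) \<Rightarrow> int \<Rightarrow> real" where
  "max_abs s j = max \<bar>s j\<bar> \<bar>s (j + 1)\<bar>"

definition uniformly_supercritical :: "(int \<Rightarrow> real) \<Rightarrow> (int \<Rightarrow> real) \<Rightarrow> bool" where
  "uniformly_supercritical l m \<longleftrightarrow>
     (SUP j. ereal (max_abs l j * (l (j + 1) - l j))) < ereal pi \<and>
     (SUP j. ereal (max_abs m j * (m (j + 1) - m j))) < ereal pi"

definition uniformly_supercritical_energy :: "(int \<Rightarrow> real) \<Rightarrow> (int \<Rightarrow> real) \<Rightarrow> bool" where
  "uniformly_supercritical_energy l m \<longleftrightarrow>
     (INF j. ereal (sqrt (ground_state_energy (l j) (l (j + 1))) / max_abs l j)) > 1 \<and>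
     (INF j. ereal (sqrt (ground_state_energy (m j) (m (j + 1))) / max_abs m j)) > 1"

definition uniformly_supercritical_spectrum :: "(int \<Rightarrow> real) \<Rightarrow> (int \<Rightarrow> real) \<Rightarrow> bool" where
  "uniformly_supercritical_spectrum l m \<longleftrightarrow>
     (INF j. ereal (sqrt (sturm_liouville_eigenvalue (l j) (l (j + 1))) / max_abs l j)) > 1 \<and>
     (INF j. ereal (sqrt (sturm_liouville_eigenvalue (m j) (m (j + 1))) / max_abs m j)) > 1"

end

theory Submission
  imports Defs "HOL-Probability.Characteristic_Functions" "HOL-Probability.Sinc_Integral"
begin

text \<open>
  On each interval \<open>I\<close> of the decomposition, a \<open>C\<^sup>1\<close> function \<open>u\<close> vanishing at the endpoints
  satisfies \<open>c \<integral>\<^sub>I x\<^sup>2 |u|\<^sup>2 \<le> \<integral>\<^sub>I |u'|\<^sup>2\<close> with a constant \<open>c > 1\<close> independent of \<open>I\<close>: under the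
  conditions on the eigenvalues this follows from their variational definition, and under the first
  condition from Wirtinger's inequality. Summing over the intervals yields
  \<open>c \<integral> x\<^sup>2 |f|\<^sup>2 \<le> \<integral> |f'|\<^sup>2 = \<integral> k\<^sup>2 |g|\<^sup>2\<close> for \<open>f\<close> with Fourier transform \<open>g\<close>, and by symmetry
  \<open>d \<integral> k\<^sup>2 |g|\<^sup>2 \<le> \<integral> x\<^sup>2 |f|\<^sup>2\<close> with \<open>d > 1\<close>. Both integrals are finite, hence zero.

  Weak derivatives of \<open>f\<close> are avoided by working with its Gaussian mollifications. They are the
  inverse Fourier integrals of \<open>g\<close> times a Gaussian, hence \<open>C\<^sup>1\<close>; on each interval an affine function
  is subtracted to restore the boundary values, and Fatou's lemma removes the mollification.
\<close>

section \<open>The Fourier integral and Gaussian weights\<close>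

text \<open>On L2 the transform is only a limit along Schwartz functions, and the inequalities see
  it through pairings with Gaussians. Such pairings are continuous under L2 convergence, and for
  integrable functions they follow from Fubini, since a Gaussian is transformed into a Gaussian. The
  derivative is only ever bounded from above by the moment of the other side, so Plancherel is
  proved as an inequality. For the symmetric half, a second mollification identity shows the
  reflection \<open>f (- x)\<close> in the role of the transform of \<open>g\<close>.

  Each condition compares a Dirichlet problem on \<open>[a, b]\<close> with the largest weight
  there: \<open>x^2 <= M^2\<close> for \<open>M = max |a| |b|\<close>. This is the origin of the
  products of \<open>M\<close> with the length and of the quotients by \<open>M\<close>. The margin
  must be uniform in the interval, since only a common \<open>c > 1\<close> survives the summation;
  with the constant 1 on both sides the two integrals would merely come out equal.\<close>

definition expint :: "(real \<Rightarrow> complex) \<Rightarrow> real \<Rightarrow> complex" where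
  "expint u x = (\<integral>k. u k * iexp (k * x) \<partial>lborel) / complex_of_real (sqrt (2 * pi))"

text \<open>The Fourier multiplier of the convolution in \<open>mollify\<close> with the same
  \<open>\<sigma>\<close>. It is normalised by its value 1 at 0, so that it tends to 1 pointwise as
  \<open>\<sigma>\<close> tends to 0.\<close>

definition gauss :: "real \<Rightarrow> real \<Rightarrow> real" where
  "gauss \<sigma> k = exp (- (\<sigma> * k)\<^sup>2 / 2)"

text \<open>Convolution with a Gaussian of deviation \<open>\<sigma>\<close>, written as the pairing
  of \<open>f\<close> with one square-integrable function of \<open>y\<close>; in this form it
  passes to L2 limits.\<close>

definition mollify :: "real \<Rightarrow> (real \<Rightarrow> complex) \<Rightarrow> real \<Rightarrow> complex" where
  "mollify \<sigma> f x = (\<integral>y. f y * complex_of_real (normal_density x \<sigma> y) \<partial>lborel)"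

lemma borel_measurable_gauss [measurable]: "gauss \<sigma> \<in> borel_measurable borel"
  unfolding gauss_def[abs_def] by measurable

lemma normal_density_commute: "normal_density x \<sigma> y = normal_density y \<sigma> x"
  by (simp add: normal_density_def power2_commute)

lemma gauss_eq_normal_density:
  assumes "\<sigma> > 0"
  shows "gauss \<sigma> k = sqrt (2 * pi) / \<sigma> * normal_density 0 (1 / \<sigma>) k"
proof -
  have "sqrt (2 * pi * (1 / \<sigma>)\<^sup>2) = sqrt (2 * pi) / \<sigma>"
    using assms by (simp add: real_sqrt_mult real_sqrt_divide power_one_over)
  thus ?thesis
    using assms unfolding gauss_def normal_density_def
    by (simp add: field_simps power2_eq_square)
qed

lemma integrable_gauss:
  assumes "\<sigma> > 0"
  shows "integrable lborel (gauss \<sigma>)"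
  using assms integrable_normal_density[of "1 / \<sigma>" 0]
  unfolding gauss_eq_normal_density[OF assms, abs_def] by simp

lemma gauss_bounds: "0 < gauss \<sigma> k" "gauss \<sigma> k \<le> 1"
  by (auto simp: gauss_def)

text \<open>The substitution \<open>y = x + \<sigma> * z\<close> reduces this to the characteristic
  function of the standard normal law. The phase comes from the centre, the decay from the
  width.\<close>

lemma normal_density_iexp:
  assumes \<sigma>: "\<sigma> > 0"
  shows "(\<integral>y. complex_of_real (normal_density x \<sigma> y) * iexp (k * y) \<partial>lborel)
           = iexp (k * x) * complex_of_real (gauss \<sigma> k)"
proof -
  have std: "(\<integral>z. complex_of_real (std_normal_density z) * iexp (t * z) \<partial>lborel)
               = complex_of_real (exp (- t\<^sup>2 / 2))" for t
  proof -
    have "(\<integral>z. complex_of_real (std_normal_density z) * iexp (t * z) \<partial>lborel)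
            = char std_normal_distribution t"
      unfolding char_def
      by (subst integral_density) (auto simp: scaleR_conv_of_real)
    thus ?thesis by (simp add: char_std_normal_distribution)
  qed
  have "(\<integral>y. complex_of_real (normal_density x \<sigma> y) * iexp (k * y) \<partial>lborel)
         = \<sigma> *\<^sub>R (\<integral>z. complex_of_real (normal_density x \<sigma> (x + \<sigma> * z)) * iexp (k * (x + \<sigma> * z)) \<partial>lborel)"
    using \<sigma> by (subst lborel_integral_real_affine[where c=\<sigma> and t=x]) auto
  also have "\<dots> = (\<integral>z. \<sigma> *\<^sub>R (complex_of_real (normal_density x \<sigma> (x + \<sigma> * z)) * iexp (k * (x + \<sigma> * z))) \<partial>lborel)"
    by simp
  also have "\<dots> = (\<integral>z. iexp (k * x) * (complex_of_real (std_normal_density z) * iexp ((k * \<sigma>) * z)) \<partial>lborel)"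
  proof (rule Bochner_Integration.integral_cong)
    fix z
    have "\<sigma> * normal_density x \<sigma> (x + \<sigma> * z) = std_normal_density z"
      using \<sigma> by (simp add: normal_density_def power_mult_distrib real_sqrt_mult)
    hence "complex_of_real \<sigma> * complex_of_real (normal_density x \<sigma> (x + \<sigma> * z)) = complex_of_real (std_normal_density z)"
      by (metis of_real_mult)
    moreover have "iexp (k * (x + \<sigma> * z)) = iexp (k * x) * iexp ((k * \<sigma>) * z)"
      by (simp add: exp_add[symmetric] algebra_simps)
    ultimately show "\<sigma> *\<^sub>R (complex_of_real (normal_density x \<sigma> (x + \<sigma> * z)) * iexp (k * (x + \<sigma> * z)))
        = iexp (k * x) * (complex_of_real (std_normal_density z) * iexp ((k * \<sigma>) * z))"
      by (simp add: scaleR_conv_of_real)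
  qed simp
  also have "\<dots> = iexp (k * x) * complex_of_real (exp (- (k * \<sigma>)\<^sup>2 / 2))"
    using std[of "k * \<sigma>"] by simp
  finally show ?thesis by (simp add: gauss_def mult.commute)
qed

text \<open>The dual of \<open>normal_density_iexp\<close>: a modulated Gaussian of width
  \<open>1 / \<sigma>\<close> becomes a density of width \<open>\<sigma>\<close> centred at the
  frequency \<open>l\<close>. Weighting by \<open>gauss\<close> on one side thus turns into
  mollifying on the other.\<close>

lemma expint_gauss:
  assumes \<sigma>: "\<sigma> > 0"
  shows "expint (\<lambda>x. iexp (- l * x) * complex_of_real (gauss \<sigma> x)) k
           = complex_of_real (sqrt (2 * pi) * normal_density l \<sigma> k)"
proof -
  have "(\<integral>x. (iexp (- l * x) * complex_of_real (gauss \<sigma> x)) * iexp (x * k) \<partial>lborel)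
      = (\<integral>x. complex_of_real (sqrt (2 * pi) / \<sigma>) *
            (complex_of_real (normal_density 0 (1 / \<sigma>) x) * iexp ((k - l) * x)) \<partial>lborel)"
    unfolding gauss_eq_normal_density[OF \<sigma>]
    by (rule Bochner_Integration.integral_cong)
       (simp_all add: exp_add[symmetric] exp_diff algebra_simps exp_minus divide_simps)
  also have "\<dots> = complex_of_real (sqrt (2 * pi) / \<sigma>) * complex_of_real (gauss (1 / \<sigma>) (k - l))"
    using normal_density_iexp[of "1 / \<sigma>" 0 "k - l"] \<sigma> by simp
  also have "\<dots> = complex_of_real (2 * pi * normal_density l \<sigma> k)"
    using \<sigma> by (simp add: normal_density_def gauss_def power_divide real_sqrt_mult field_simps
        flip: of_real_mult of_real_divide)
  finally show ?thesis
    unfolding expint_def using real_sqrt_pow2[of "2 * pi"]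
    by (simp add: field_simps power2_eq_square flip: of_real_mult of_real_divide)
qed

lemma integrable_mult_iexp:
  assumes "integrable lborel u"
  shows "integrable lborel (\<lambda>k. u k * iexp (k * x))"
  by (rule Bochner_Integration.integrable_bound[OF assms])
     (use borel_measurable_integrable[OF assms] in \<open>auto simp: norm_mult\<close>)

lemma borel_measurable_expint [measurable]:
  assumes [measurable]: "u \<in> borel_measurable borel"
  shows "expint u \<in> borel_measurable borel"
  unfolding expint_def[abs_def] by measurable

lemma norm_expint_le:
  shows "norm (expint u x) \<le> (\<integral>k. norm (u k) \<partial>lborel) / sqrt (2 * pi)"
proof -
  have "norm (\<integral>k. u k * iexp (k * x) \<partial>lborel) \<le> (\<integral>k. norm (u k * iexp (k * x)) \<partial>lborel)"
    by (rule integral_norm_bound)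
  thus ?thesis unfolding expint_def by (simp add: norm_divide norm_mult divide_right_mono)
qed

text \<open>Fubini, since the kernel \<open>iexp (k * x)\<close> is symmetric in \<open>k\<close>
  and \<open>x\<close> and of modulus 1. Both mollification formulas and the Plancherel inequality
  below rest on it.\<close>

lemma expint_multiplication:
  assumes u: "integrable lborel u" and w: "integrable lborel w"
  shows "(\<integral>x. expint u x * w x \<partial>lborel) = (\<integral>k. u k * expint w k \<partial>lborel)"
proof -
  note [measurable] = borel_measurable_integrable[OF u] borel_measurable_integrable[OF w]
  have int: "integrable (lborel \<Otimes>\<^sub>M lborel) (\<lambda>(k, x). u k * w x * iexp (k * x))"
  proof (rule lborel_pair.Fubini_integrable)
    show "integrable lborel (\<lambda>k. LINT x|lborel. norm (case (k, x) of (k, x) \<Rightarrow> u k * w x * iexp (k * x)))"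
      using integrable_norm[OF u] by (simp add: norm_mult)
    show "AE k in lborel. integrable lborel (\<lambda>x. case (k, x) of (k, x) \<Rightarrow> u k * w x * iexp (k * x))"
    proof (rule AE_I2)
      fix k
      have "integrable lborel (\<lambda>x. u k * (w x * iexp (x * k)))"
        using integrable_mult_iexp[OF w, of k] by auto
      thus "integrable lborel (\<lambda>x. case (k, x) of (k, x) \<Rightarrow> u k * w x * iexp (k * x))"
        by (simp add: mult_ac)
    qed
  qed measurable
  have "(\<integral>x. (\<integral>k. u k * w x * iexp (k * x) \<partial>lborel) \<partial>lborel)
      = (\<integral>k. (\<integral>x. u k * w x * iexp (k * x) \<partial>lborel) \<partial>lborel)"
    by (rule lborel_pair.Fubini_integral[OF int])
  moreover have "expint u x * w x
      = (\<integral>k. u k * w x * iexp (k * x) \<partial>lborel) / complex_of_real (sqrt (2 * pi))" for x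
  proof -
    have "(\<integral>k. u k * w x * iexp (k * x) \<partial>lborel) = (\<integral>k. u k * iexp (k * x) \<partial>lborel) * w x"
      by (subst integral_mult_left_zero[symmetric]) (simp add: mult_ac)
    thus ?thesis by (simp add: expint_def)
  qed
  moreover have "u k * expint w k
      = (\<integral>x. u k * w x * iexp (k * x) \<partial>lborel) / complex_of_real (sqrt (2 * pi))" for k
  proof -
    have "(\<integral>x. u k * w x * iexp (k * x) \<partial>lborel) = u k * (\<integral>x. w x * iexp (x * k) \<partial>lborel)"
      by (subst integral_mult_right_zero[symmetric]) (simp add: mult_ac)
    thus ?thesis by (simp add: expint_def)
  qed
  ultimately show ?thesis by (simp only: integral_divide_zero)
qed

lemma integrable_iexp_gauss:
  assumes "\<sigma> > 0"
  shows "integrable lborel (\<lambda>x. iexp (l * x) * complex_of_real (gauss \<sigma> x))"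
  by (rule Bochner_Integration.integrable_bound[OF integrable_gauss[OF assms]])
     (auto simp: norm_mult)

lemma mollify_expint:
  assumes u: "integrable lborel u" and \<sigma>: "\<sigma> > 0"
  shows "mollify \<sigma> (expint u) x = expint (\<lambda>k. u k * complex_of_real (gauss \<sigma> k)) x"
proof -
  have "mollify \<sigma> (expint u) x
      = (\<integral>k. u k * expint (\<lambda>y. complex_of_real (normal_density x \<sigma> y)) k \<partial>lborel)"
    unfolding mollify_def
    by (rule expint_multiplication[OF u]) (use \<sigma> integrable_normal_density[OF \<sigma>, of x] in auto)
  also have "expint (\<lambda>y. complex_of_real (normal_density x \<sigma> y))
      = (\<lambda>k. complex_of_real (gauss \<sigma> k) * iexp (k * x) / complex_of_real (sqrt (2 * pi)))"
    unfolding expint_def using normal_density_iexp[OF \<sigma>, of x] by (simp add: mult_ac)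
  finally have "mollify \<sigma> (expint u) x = (\<integral>k. u k * complex_of_real (gauss \<sigma> k) * iexp (k * x) /
      complex_of_real (sqrt (2 * pi)) \<partial>lborel)"
    by (simp add: mult_ac)
  thus ?thesis by (simp add: expint_def)
qed

text \<open>Inversion regularised by a Gaussian: the multiplication formula moves the inner
  \<open>expint\<close> onto the modulated Gaussian, whose transform is the density centred at
  \<open>l\<close>. It is exact for every \<open>\<sigma>\<close>, not just in the limit.\<close>

lemma expint_expint_gauss:
  assumes u: "integrable lborel u" and \<sigma>: "\<sigma> > 0"
  shows "expint (\<lambda>x. expint u x * complex_of_real (gauss \<sigma> x)) (- l) = mollify \<sigma> u l"
proof -
  have "expint (\<lambda>x. expint u x * complex_of_real (gauss \<sigma> x)) (- l)
      = (\<integral>x. expint u x * (iexp (- l * x) * complex_of_real (gauss \<sigma> x)) \<partial>lborel) / complex_of_real (sqrt (2 * pi))"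
    unfolding expint_def[of "\<lambda>x. expint u x * _ x"] by (simp add: mult_ac)
  also have "\<dots> = (\<integral>k. u k * (complex_of_real (sqrt (2 * pi) * normal_density l \<sigma> k)) \<partial>lborel) / complex_of_real (sqrt (2 * pi))"
    using expint_gauss[OF \<sigma>, of l] integrable_iexp_gauss[OF \<sigma>, of "- l"]
    by (subst expint_multiplication[OF u]) simp_all
  also have "\<dots> = mollify \<sigma> u l"
    unfolding mollify_def
    by (subst integral_divide_zero[symmetric]) (simp add: mult_ac)
  finally show ?thesis .
qed

section \<open>The Plancherel inequality\<close>

text \<open>Fatou's lemma as a bound: a uniform bound on the integrals survives an almost everywhere
  limit. It removes the Gaussian in \<open>plancherel_le\<close> and the mollification in
  \<open>hardy_inequality\<close>.\<close>

lemma nn_integral_le_of_tendsto: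
  fixes u :: "nat \<Rightarrow> 'a \<Rightarrow> ennreal"
  assumes [measurable]: "\<And>n. u n \<in> borel_measurable M"
    and lim: "AE x in M. (\<lambda>n. u n x) \<longlonglongrightarrow> v x"
    and le: "\<And>n. (\<integral>\<^sup>+x. u n x \<partial>M) \<le> C"
  shows "(\<integral>\<^sup>+x. v x \<partial>M) \<le> C"
proof -
  have "(\<integral>\<^sup>+x. v x \<partial>M) = (\<integral>\<^sup>+x. liminf (\<lambda>n. u n x) \<partial>M)"
    using lim by (intro nn_integral_cong_AE) (auto elim!: eventually_mono simp: lim_imp_Liminf)
  also have "\<dots> \<le> liminf (\<lambda>n. \<integral>\<^sup>+x. u n x \<partial>M)"
    by (rule nn_integral_liminf) simp
  also have "\<dots> \<le> C"
    using le by (intro Liminf_le) auto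
  finally show ?thesis .
qed

text \<open>If \<open>f\<close> is not integrable, the left side is 0 by the convention for the
  Bochner integral.\<close>

lemma norm_integral_le_nn_integral:
  fixes f :: "'a \<Rightarrow> 'b :: {banach, second_countable_topology}"
  shows "ennreal (norm (integral\<^sup>L M f)) \<le> (\<integral>\<^sup>+x. ennreal (norm (f x)) \<partial>M)"
  by (cases "integrable M f") (simp_all add: integral_norm_bound_ennreal not_integrable_integral_eq)

lemma nn_integral_normal_density:
  assumes "\<sigma> > 0"
  shows "(\<integral>\<^sup>+y. ennreal (normal_density x \<sigma> y) \<partial>lborel) = 1"
  using assms by (simp add: nn_integral_eq_integral)

text \<open>A Schur test: the product \<open>|u k| |u y|\<close> is split into half the sum of the
  squares, and the density is a symmetric kernel of mass 1, so each of the two parts integrates to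
  half of the right side.\<close>

lemma nn_integral_norm_mollify_le:
  assumes [measurable]: "u \<in> borel_measurable borel" and \<sigma>: "\<sigma> > 0"
  shows "(\<integral>\<^sup>+k. ennreal (norm (u k) * norm (mollify \<sigma> u k)) \<partial>lborel)
           \<le> (\<integral>\<^sup>+k. ennreal ((norm (u k))\<^sup>2) \<partial>lborel)"
proof -
  let ?N = "\<integral>\<^sup>+k. ennreal ((norm (u k))\<^sup>2) \<partial>lborel"
  let ?d = "\<lambda>k y. normal_density k \<sigma> y"
  have [measurable]: "(\<lambda>(k, y). ?d k y) \<in> borel_measurable (borel \<Otimes>\<^sub>M borel)"
    unfolding normal_density_def by measurable
  have half: "(\<integral>\<^sup>+y. ennreal (1/2 * (norm (u k))\<^sup>2 * ?d k y) \<partial>lborel) = ennreal (1/2 * (norm (u k))\<^sup>2)" for k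
    using nn_integral_normal_density[OF \<sigma>, of k]
    by (subst ennreal_mult) (auto simp: nn_integral_cmult)
  have "(\<integral>\<^sup>+k. ennreal (norm (u k) * norm (mollify \<sigma> u k)) \<partial>lborel)
      \<le> (\<integral>\<^sup>+k. (\<integral>\<^sup>+y. ennreal (norm (u k) * (norm (u y) * ?d k y)) \<partial>lborel) \<partial>lborel)"
  proof (rule nn_integral_mono)
    fix k
    have "ennreal (norm (mollify \<sigma> u k)) \<le> (\<integral>\<^sup>+y. ennreal (norm (u y) * ?d k y) \<partial>lborel)"
      unfolding mollify_def
      by (rule order_trans[OF norm_integral_le_nn_integral]) (simp add: norm_mult)
    hence "ennreal (norm (u k)) * ennreal (norm (mollify \<sigma> u k))
        \<le> ennreal (norm (u k)) * (\<integral>\<^sup>+y. ennreal (norm (u y) * ?d k y) \<partial>lborel)"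
      by (rule mult_left_mono) simp
    thus "ennreal (norm (u k) * norm (mollify \<sigma> u k))
        \<le> (\<integral>\<^sup>+y. ennreal (norm (u k) * (norm (u y) * ?d k y)) \<partial>lborel)"
      by (simp add: ennreal_mult nn_integral_cmult)
  qed
  also have "\<dots> \<le> (\<integral>\<^sup>+k. (\<integral>\<^sup>+y. ennreal (1/2 * (norm (u k))\<^sup>2 * ?d k y) + ennreal (1/2 * (norm (u y))\<^sup>2 * ?d k y) \<partial>lborel) \<partial>lborel)"
  proof (intro nn_integral_mono)
    fix k y
    have "norm (u k) * norm (u y) \<le> 1/2 * (norm (u k))\<^sup>2 + 1/2 * (norm (u y))\<^sup>2"
      using sum_squares_bound[of "norm (u k)" "norm (u y)"] by (simp add: field_simps)
    from mult_right_mono[OF this normal_density_nonneg[of k \<sigma> y]]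
    show "ennreal (norm (u k) * (norm (u y) * ?d k y))
        \<le> ennreal (1/2 * (norm (u k))\<^sup>2 * ?d k y) + ennreal (1/2 * (norm (u y))\<^sup>2 * ?d k y)"
      by (simp add: algebra_simps flip: ennreal_plus)
  qed
  also have "\<dots> = (\<integral>\<^sup>+k. (\<integral>\<^sup>+y. ennreal (1/2 * (norm (u k))\<^sup>2 * ?d k y) \<partial>lborel) \<partial>lborel)
      + (\<integral>\<^sup>+k. (\<integral>\<^sup>+y. ennreal (1/2 * (norm (u y))\<^sup>2 * ?d k y) \<partial>lborel) \<partial>lborel)"
    by (subst nn_integral_add[symmetric]) (auto intro!: nn_integral_cong nn_integral_add)
  also have "(\<integral>\<^sup>+k. (\<integral>\<^sup>+y. ennreal (1/2 * (norm (u y))\<^sup>2 * ?d k y) \<partial>lborel) \<partial>lborel)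
      = (\<integral>\<^sup>+y. (\<integral>\<^sup>+k. ennreal (1/2 * (norm (u y))\<^sup>2 * ?d k y) \<partial>lborel) \<partial>lborel)"
    by (rule lborel_pair.Fubini') measurable
  also have "\<dots> = (\<integral>\<^sup>+y. (\<integral>\<^sup>+k. ennreal (1/2 * (norm (u y))\<^sup>2 * ?d y k) \<partial>lborel) \<partial>lborel)"
    by (simp add: normal_density_commute)
  also have "(\<integral>\<^sup>+k. (\<integral>\<^sup>+y. ennreal (1/2 * (norm (u k))\<^sup>2 * ?d k y) \<partial>lborel) \<partial>lborel) + \<dots>
      = ?N"
    unfolding half
    by (subst nn_integral_add[symmetric]) (auto intro!: nn_integral_cong simp flip: ennreal_plus)
  finally show ?thesis .
qed

lemma cnj_expint: "cnj (expint u x) = expint (\<lambda>k. cnj (u k)) (- x)"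
proof -
  have "cnj (u k * iexp (k * x)) = cnj (u k) * iexp (k * (- x))" for k
    by (simp add: exp_cnj)
  hence "cnj (\<integral>k. u k * iexp (k * x) \<partial>lborel) = (\<integral>k. cnj (u k) * iexp (k * (- x)) \<partial>lborel)"
    by (subst Bochner_Integration.integral_cnj[symmetric]) (simp only:)
  thus ?thesis by (simp only: expint_def complex_cnj_divide complex_cnj_complex_of_real)
qed

text \<open>
  With the weight \<^const>\<open>gauss\<close> \<open>\<sigma>\<close> on the left, the integral equals that of \<open>u\<close> times the conjugate
  of its mollification; then \<open>\<sigma>\<close> tends to \<open>0\<close>.
\<close>

lemma plancherel_le:
  assumes u: "integrable lborel u"
  shows "(\<integral>\<^sup>+x. ennreal ((norm (expint u x))\<^sup>2) \<partial>lborel) \<le> (\<integral>\<^sup>+k. ennreal ((norm (u k))\<^sup>2) \<partial>lborel)"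
proof (rule nn_integral_le_of_tendsto)
  note [measurable] = borel_measurable_integrable[OF u]
  fix n :: nat
  define \<sigma> where "\<sigma> = 1 / real (Suc n)"
  have \<sigma>: "\<sigma> > 0" by (simp add: \<sigma>_def)
  define B where "B = (\<integral>k. norm (u k) \<partial>lborel) / sqrt (2 * pi)"
  have B: "norm (expint u x) \<le> B" for x
    using norm_expint_le[of u x] by (simp add: B_def)
  have B0: "B \<ge> 0" using order_trans[OF norm_ge_zero B[of 0]] .
  let ?p = "\<lambda>x. expint u x * complex_of_real (gauss \<sigma> x)"
  have p: "integrable lborel ?p"
    by (rule Bochner_Integration.integrable_bound[OF integrable_mult_right[OF integrable_gauss[OF \<sigma>], of B]])
       (use B B0 gauss_bounds[of \<sigma>] in \<open>auto simp: norm_mult abs_mult less_imp_le intro!: mult_right_mono\<close>)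
  have pp: "integrable lborel (\<lambda>x. (norm (expint u x))\<^sup>2 * gauss \<sigma> x)"
    by (rule Bochner_Integration.integrable_bound[OF integrable_mult_right[OF integrable_gauss[OF \<sigma>], of "B\<^sup>2"]])
       (use B B0 gauss_bounds[of \<sigma>] in \<open>auto simp: norm_mult abs_mult less_imp_le intro!: mult_right_mono power_mono\<close>)
  have "complex_of_real (\<integral>x. (norm (expint u x))\<^sup>2 * gauss \<sigma> x \<partial>lborel)
      = (\<integral>x. complex_of_real ((norm (expint u x))\<^sup>2 * gauss \<sigma> x) \<partial>lborel)"
    by (rule integral_complex_of_real[symmetric])
  also have "\<dots> = (\<integral>x. expint u x * cnj (?p x) \<partial>lborel)"
    by (simp only: of_real_mult complex_norm_square complex_cnj_mult complex_cnj_complex_of_real mult.assoc)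
  also have "\<dots> = (\<integral>k. u k * expint (\<lambda>x. cnj (?p x)) k \<partial>lborel)"
    by (rule expint_multiplication[OF u integrable_cnj[OF p]])
  also have "(\<lambda>k. expint (\<lambda>x. cnj (?p x)) k) = (\<lambda>k. cnj (mollify \<sigma> u k))"
  proof
    fix k
    show "expint (\<lambda>x. cnj (?p x)) k = cnj (mollify \<sigma> u k)"
      unfolding expint_expint_gauss[OF u \<sigma>, symmetric] cnj_expint by simp
  qed
  finally have eq: "complex_of_real (\<integral>x. (norm (expint u x))\<^sup>2 * gauss \<sigma> x \<partial>lborel)
      = (\<integral>k. u k * cnj (mollify \<sigma> u k) \<partial>lborel)" .
  have "(\<integral>\<^sup>+x. ennreal ((norm (expint u x))\<^sup>2 * gauss \<sigma> x) \<partial>lborel)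
      = ennreal (\<integral>x. (norm (expint u x))\<^sup>2 * gauss \<sigma> x \<partial>lborel)"
    using gauss_bounds[of \<sigma>] by (intro nn_integral_eq_integral pp) (auto simp: less_imp_le)
  also have "\<dots> \<le> ennreal (norm (complex_of_real (\<integral>x. (norm (expint u x))\<^sup>2 * gauss \<sigma> x \<partial>lborel)))"
    by (intro ennreal_leI) simp
  also have "\<dots> \<le> (\<integral>\<^sup>+k. ennreal (norm (u k) * norm (mollify \<sigma> u k)) \<partial>lborel)"
    unfolding eq by (rule order_trans[OF norm_integral_le_nn_integral]) (simp add: norm_mult)
  also have "\<dots> \<le> (\<integral>\<^sup>+k. ennreal ((norm (u k))\<^sup>2) \<partial>lborel)"
    by (rule nn_integral_norm_mollify_le[OF _ \<sigma>]) simp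
  finally show "(\<integral>\<^sup>+x. ennreal ((norm (expint u x))\<^sup>2 * gauss (1 / real (Suc n)) x) \<partial>lborel)
      \<le> (\<integral>\<^sup>+k. ennreal ((norm (u k))\<^sup>2) \<partial>lborel)"
    unfolding \<sigma>_def .
next
  note [measurable] = borel_measurable_integrable[OF u]
  show "(\<lambda>x. ennreal ((norm (expint u x))\<^sup>2 * gauss (1 / real (Suc n)) x)) \<in> borel_measurable lborel" for n
    by measurable
  show "AE x in lborel. (\<lambda>n. ennreal ((norm (expint u x))\<^sup>2 * gauss (1 / real (Suc n)) x))
      \<longlonglongrightarrow> ennreal ((norm (expint u x))\<^sup>2)"
  proof (rule AE_I2, rule tendsto_ennrealI)
    fix x
    have "(\<lambda>n. (norm (expint u x))\<^sup>2 * gauss (1 / real (Suc n)) x) \<longlonglongrightarrow> (norm (expint u x))\<^sup>2 * exp (- (0 * x)\<^sup>2 / 2)"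
      unfolding gauss_def by (intro tendsto_intros LIMSEQ_Suc lim_1_over_n) simp
    thus "(\<lambda>n. (norm (expint u x))\<^sup>2 * gauss (1 / real (Suc n)) x) \<longlonglongrightarrow> (norm (expint u x))\<^sup>2"
      by simp
  qed
qed

section \<open>The Fourier transform on square-integrable functions\<close>

lemma L2_onD:
  assumes "f \<in> L2_on UNIV"
  shows "f \<in> borel_measurable borel" "integrable lborel (\<lambda>x. (norm (f x))\<^sup>2)"
  using assms unfolding L2_on_def set_borel_measurable_def set_integrable_def by auto

lemma integrable_mult_L2:
  fixes f w :: "real \<Rightarrow> complex"
  assumes f: "f \<in> L2_on UNIV" and w: "w \<in> L2_on UNIV"
  shows "integrable lborel (\<lambda>x. f x * w x)"
proof (rule Bochner_Integration.integrable_bound)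
  note [measurable] = L2_onD(1)[OF f] L2_onD(1)[OF w]
  show "integrable lborel (\<lambda>x. (norm (f x))\<^sup>2 + (norm (w x))\<^sup>2)"
    using L2_onD(2)[OF f] L2_onD(2)[OF w] by simp
  show "(\<lambda>x. f x * w x) \<in> borel_measurable lborel" by measurable
  show "AE x in lborel. norm (f x * w x) \<le> norm ((norm (f x))\<^sup>2 + (norm (w x))\<^sup>2)"
  proof (rule AE_I2)
    fix x
    have "norm (f x) * norm (w x) \<le> 2 * norm (f x) * norm (w x)" by simp
    also have "\<dots> \<le> (norm (f x))\<^sup>2 + (norm (w x))\<^sup>2" by (rule sum_squares_bound)
    finally show "norm (f x * w x) \<le> norm ((norm (f x))\<^sup>2 + (norm (w x))\<^sup>2)"
      by (simp add: norm_mult)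
  qed
qed

text \<open>Cauchy-Schwarz for the pairing with a fixed \<open>w\<close>. Integrability of the
  products is a separate assumption, as it is obtained in different ways for Schwartz functions and
  for their transforms.\<close>

lemma L2_tendsto_integral:
  fixes f w :: "real \<Rightarrow> complex"
  assumes lim: "L2_tendsto \<phi> f"
    and \<phi>: "\<And>n. integrable lborel (\<lambda>x. \<phi> n x * w x)" "\<And>n. \<phi> n \<in> borel_measurable borel"
    and f: "f \<in> L2_on UNIV" and w: "w \<in> L2_on UNIV"
  shows "(\<lambda>n. \<integral>x. \<phi> n x * w x \<partial>lborel) \<longlonglongrightarrow> (\<integral>x. f x * w x \<partial>lborel)"
proof -
  note [measurable] = L2_onD(1)[OF f] L2_onD(1)[OF w] \<phi>(2)
  let ?e = "\<lambda>n. \<integral>\<^sup>+x. ennreal ((norm (\<phi> n x - f x))\<^sup>2) \<partial>lborel"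
  let ?d = "\<lambda>n. norm ((\<integral>x. \<phi> n x * w x \<partial>lborel) - (\<integral>x. f x * w x \<partial>lborel))"
  define W where "W = (\<integral>\<^sup>+x. ennreal ((norm (w x))\<^sup>2) \<partial>lborel)"
  have W: "W < \<infinity>"
    unfolding W_def using L2_onD(2)[OF w] by (simp add: nn_integral_eq_integral)
  have bound: "ennreal ((?d n)\<^sup>2) \<le> ?e n * W" for n
  proof -
    have "(\<integral>x. \<phi> n x * w x \<partial>lborel) - (\<integral>x. f x * w x \<partial>lborel) = (\<integral>x. (\<phi> n x - f x) * w x \<partial>lborel)"
      using \<phi>(1)[of n] integrable_mult_L2[OF f w]
      by (simp add: algebra_simps)
    hence "ennreal (?d n) \<le> (\<integral>\<^sup>+x. ennreal (norm (\<phi> n x - f x)) * ennreal (norm (w x)) \<partial>lborel)"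
      using norm_integral_le_nn_integral[of lborel "\<lambda>x. (\<phi> n x - f x) * w x"]
      by (simp add: norm_mult ennreal_mult)
    hence "ennreal (?d n) ^ 2 \<le> (\<integral>\<^sup>+x. ennreal (norm (\<phi> n x - f x)) * ennreal (norm (w x)) \<partial>lborel)\<^sup>2"
      by (rule power_mono) simp
    also have "\<dots> \<le> (\<integral>\<^sup>+x. ennreal (norm (\<phi> n x - f x)) ^ 2 \<partial>lborel) * (\<integral>\<^sup>+x. ennreal (norm (w x)) ^ 2 \<partial>lborel)"
      by (rule Cauchy_Schwarz_nn_integral) measurable
    finally show ?thesis by (simp add: ennreal_power W_def)
  qed
  \<comment> \<open>Finiteness of \<open>W\<close> excludes the limit form 0 times infinity, where
    multiplication is discontinuous.\<close>
  have "(\<lambda>n. ?e n * W) \<longlonglongrightarrow> 0 * W"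
    by (rule tendsto_mult_ennreal)
       (use lim W in \<open>auto simp: L2_tendsto_def\<close>)
  hence "(\<lambda>n. ?e n * W) \<longlonglongrightarrow> 0" by simp
  hence "(\<lambda>n. ennreal ((?d n)\<^sup>2)) \<longlonglongrightarrow> 0"
    by (rule tendsto_sandwich[OF _ _ tendsto_const, rotated 2]) (use bound in auto)
  hence "(\<lambda>n. (?d n)\<^sup>2) \<longlonglongrightarrow> 0"
    by (subst tendsto_ennreal_iff[symmetric]) auto
  from tendsto_real_sqrt[OF this] have "(\<lambda>n. ?d n) \<longlonglongrightarrow> 0"
    by simp
  thus ?thesis
    by (simp add: tendsto_norm_zero_iff Lim_null[symmetric])
qed

lemma schwartz_continuous:
  assumes "schwartz \<phi>"
  shows "continuous_on UNIV \<phi>"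
proof -
  have "\<phi> differentiable at x" for x
    using assms unfolding schwartz_def smooth_def by (metis funpow_0)
  thus ?thesis
    by (simp add: continuous_at_imp_continuous_on differentiable_imp_continuous_within)
qed

lemma integrable_inverse_1_plus_square_lborel:
  "integrable lborel (\<lambda>x::real. inverse (1 + x\<^sup>2))"
  using integrable_inverse_1_plus_square by (simp add: set_integrable_def)

text \<open>Bounds on \<open>\<phi>\<close> and on \<open>x^2 \<phi>\<close> add up to a majorant
  that is a multiple of \<open>1 / (1 + x^2)\<close>.\<close>

lemma schwartz_integrable:
  assumes \<phi>: "schwartz \<phi>"
  shows "integrable lborel \<phi>"
proof -
  have [measurable]: "\<phi> \<in> borel_measurable borel"
    by (rule borel_measurable_continuous_onI[OF schwartz_continuous[OF \<phi>]])
  have b: "bounded (range (\<lambda>x. x ^ m *\<^sub>R \<phi> x))" for m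
    using \<phi> unfolding schwartz_def by (metis funpow_0)
  obtain C0 where C0: "\<And>x. norm (\<phi> x) \<le> C0"
    using b[of 0] by (auto simp: bounded_iff)
  obtain C2 where C2: "\<And>x. norm (x\<^sup>2 *\<^sub>R \<phi> x) \<le> C2"
    using b[of 2] by (auto simp: bounded_iff)
  show ?thesis
  proof (rule Bochner_Integration.integrable_bound)
    show "integrable lborel (\<lambda>x. (C0 + C2) * inverse (1 + x\<^sup>2))"
      using integrable_inverse_1_plus_square_lborel by simp
    show "AE x in lborel. norm (\<phi> x) \<le> norm ((C0 + C2) * inverse (1 + x\<^sup>2))"
    proof (rule AE_I2)
      fix x
      have "norm (\<phi> x) * (1 + x\<^sup>2) \<le> C0 + C2"
        using C0[of x] C2[of x] by (simp add: algebra_simps)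
      hence "norm (\<phi> x) \<le> (C0 + C2) * inverse (1 + x\<^sup>2)"
        by (simp add: divide_simps add_pos_nonneg)
      thus "norm (\<phi> x) \<le> norm ((C0 + C2) * inverse (1 + x\<^sup>2))"
        by simp
    qed
  qed simp
qed

lemma fourier_integral_eq_expint: "fourier_integral \<phi> k = expint \<phi> (- k)"
  unfolding fourier_integral_def expint_def by (simp add: mult_ac)

lemma gauss_L2:
  assumes "\<sigma> > 0"
  shows "(\<lambda>k. iexp (k * x) * complex_of_real (gauss \<sigma> k)) \<in> L2_on UNIV"
proof -
  have "integrable lborel (\<lambda>k. (gauss \<sigma> k)\<^sup>2)"
    by (rule Bochner_Integration.integrable_bound[OF integrable_gauss[OF assms]])
       (use gauss_bounds[of \<sigma>] in \<open>auto simp: power2_eq_square less_imp_le intro!: mult_left_le\<close>)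
  thus ?thesis
    unfolding L2_on_def set_borel_measurable_def set_integrable_def
    by (simp add: norm_mult)
qed

lemma normal_density_le: "normal_density x \<sigma> y \<le> 1 / sqrt (2 * pi * \<sigma>\<^sup>2)"
  unfolding normal_density_def by (rule mult_left_le) auto

lemma normal_density_L2:
  assumes \<sigma>: "\<sigma> > 0"
  shows "(\<lambda>y. complex_of_real (normal_density x \<sigma> y)) \<in> L2_on UNIV"
proof -
  have "integrable lborel (\<lambda>y. (normal_density x \<sigma> y)\<^sup>2)"
    by (rule Bochner_Integration.integrable_bound[OF integrable_mult_right
          [OF integrable_normal_density[OF \<sigma>, of x], of "1 / sqrt (2 * pi * \<sigma>\<^sup>2)"]])
       (auto simp: power2_eq_square[of "normal_density x \<sigma> _"] abs_mult simp del: times_divide_eq_left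
             intro!: mult_right_mono normal_density_le)
  thus ?thesis
    unfolding L2_on_def set_borel_measurable_def set_integrable_def by simp
qed

text \<open>For Schwartz functions both identities come from the multiplication formula. Each side
  is a pairing with a fixed square-integrable Gaussian and so passes to the L2 limit. The second
  identity is inversion seen through a mollifier: the transform of \<open>g\<close> is the
  reflection of \<open>f\<close>.\<close>

lemma fourier_transform_mollify:
  assumes fg: "has_fourier_transform f g" and \<sigma>: "\<sigma> > 0"
  shows "mollify \<sigma> f x = expint (\<lambda>k. g k * complex_of_real (gauss \<sigma> k)) x"
    and "mollify \<sigma> g x = expint (\<lambda>k. f k * complex_of_real (gauss \<sigma> k)) (- x)"
proof -
  from fg obtain \<phi> where \<phi>: "\<And>n. schwartz (\<phi> n)" and l1: "L2_tendsto \<phi> f"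
    and l2: "L2_tendsto (\<lambda>n. fourier_integral (\<phi> n)) g"
    and f: "f \<in> L2_on UNIV" and g: "g \<in> L2_on UNIV"
    unfolding has_fourier_transform_def by blast
  let ?h = "\<lambda>n. fourier_integral (\<phi> n)"
  have int: "integrable lborel (\<phi> n)" for n by (rule schwartz_integrable[OF \<phi>])
  note [measurable] = borel_measurable_integrable[OF int]
  have h_meas [measurable]: "?h n \<in> borel_measurable borel" for n
    unfolding fourier_integral_eq_expint[abs_def] by measurable
  have h_bound: "\<exists>B. \<forall>k. norm (?h n k) \<le> B" for n
    unfolding fourier_integral_eq_expint using norm_expint_le by blast
  let ?e = "\<lambda>x k. iexp (k * x) * complex_of_real (gauss \<sigma> k)"
  let ?d = "\<lambda>x y. complex_of_real (normal_density x \<sigma> y)"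
  \<comment> \<open>One factor is bounded and the other integrable. The transforms
    \<open>?h n\<close> serve as the bounded factor and the \<open>\<phi> n\<close> as the
    integrable one, hence this version and its mirror image \<open>swap\<close>.\<close>
  have bdd_int: "integrable lborel (\<lambda>k. u k * w k)"
    if "\<exists>B. \<forall>k::real. norm (u k) \<le> B" "integrable lborel w" "u \<in> borel_measurable borel" for u w :: "real \<Rightarrow> complex"
  proof -
    from that(1) obtain B where B: "norm (u k) \<le> B" for k by blast
    have "B \<ge> 0" using order_trans[OF norm_ge_zero B] .
    note [measurable] = that(3) borel_measurable_integrable[OF that(2)]
    show ?thesis
      by (rule Bochner_Integration.integrable_bound[OF integrable_mult_right[OF integrable_norm[OF that(2)], of B]])
         (use B \<open>B \<ge> 0\<close> in \<open>auto simp: norm_mult intro!: mult_right_mono\<close>)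
  qed
  have e_int: "integrable lborel (?e x)" for x
    using integrable_iexp_gauss[OF \<sigma>, of x] by (simp add: mult_ac)
  have e_bdd: "\<exists>B. \<forall>k. norm (?e x k) \<le> B" for x
    using gauss_bounds[of \<sigma>] by (intro exI[of _ 1]) (auto simp: norm_mult less_imp_le)
  have d_int: "integrable lborel (?d x)" for x
    using integrable_normal_density[OF \<sigma>, of x] by simp
  have d_bdd: "\<exists>B. \<forall>k. norm (?d x k) \<le> B" for x
    using normal_density_le[of x \<sigma>] by (intro exI[of _ "1 / sqrt (2 * pi * \<sigma>\<^sup>2)"] allI) simp
  have swap: "integrable lborel (\<lambda>k. u k * w k)"
    if "\<exists>B. \<forall>k. norm (w k) \<le> B" "integrable lborel u" "w \<in> borel_measurable borel" for u w :: "real \<Rightarrow> complex"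
    using bdd_int[OF that] by (simp add: mult.commute)
  have conv: "expint (\<lambda>k. u k * complex_of_real (gauss \<sigma> k)) y
      = (\<integral>k. u k * ?e y k \<partial>lborel) / complex_of_real (sqrt (2 * pi))" for u y
    unfolding expint_def by (simp add: mult_ac)

  have a1: "(\<lambda>n. mollify \<sigma> (\<phi> n) x) \<longlonglongrightarrow> mollify \<sigma> f x"
    unfolding mollify_def
    by (rule L2_tendsto_integral[OF l1 swap[OF d_bdd int] _ f normal_density_L2[OF \<sigma>]]) measurable
  have a2: "(\<lambda>n. expint (\<lambda>k. ?h n k * complex_of_real (gauss \<sigma> k)) x) \<longlonglongrightarrow> expint (\<lambda>k. g k * complex_of_real (gauss \<sigma> k)) x"
    unfolding conv
    by (intro tendsto_divide tendsto_const
        L2_tendsto_integral[OF l2 bdd_int[OF h_bound e_int h_meas] h_meas g gauss_L2[OF \<sigma>]]) simp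
  \<comment> \<open>Substituting \<open>- k\<close> turns \<open>fourier_integral\<close> into
    \<open>expint\<close>; the Gaussian is even.\<close>
  have a3: "expint (\<lambda>k. ?h n k * complex_of_real (gauss \<sigma> k)) x = mollify \<sigma> (\<phi> n) x" for n
  proof -
    have "expint (\<lambda>k. ?h n k * complex_of_real (gauss \<sigma> k)) x
        = expint (\<lambda>k. expint (\<phi> n) k * complex_of_real (gauss \<sigma> k)) (- x)"
      unfolding expint_def[of "\<lambda>k. _ k * complex_of_real (gauss \<sigma> k)"]
      by (subst lborel_integral_real_affine[where c="-1" and t=0])
         (simp_all add: fourier_integral_eq_expint gauss_def)
    also have "\<dots> = mollify \<sigma> (\<phi> n) x"
      by (rule expint_expint_gauss[OF int \<sigma>])
    finally show ?thesis .
  qed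
  show "mollify \<sigma> f x = expint (\<lambda>k. g k * complex_of_real (gauss \<sigma> k)) x"
    using LIMSEQ_unique[OF a1] a2 unfolding a3 by blast

  have b1: "(\<lambda>n. mollify \<sigma> (?h n) x) \<longlonglongrightarrow> mollify \<sigma> g x"
    unfolding mollify_def
    by (rule L2_tendsto_integral[OF l2 bdd_int[OF h_bound d_int h_meas] h_meas g normal_density_L2[OF \<sigma>]])
  have b2: "(\<lambda>n. expint (\<lambda>k. \<phi> n k * complex_of_real (gauss \<sigma> k)) (- x)) \<longlonglongrightarrow> expint (\<lambda>k. f k * complex_of_real (gauss \<sigma> k)) (- x)"
    unfolding conv
    by (intro tendsto_divide tendsto_const
        L2_tendsto_integral[OF l1 swap[OF e_bdd int] _ f gauss_L2[OF \<sigma>]]) (simp_all, measurable)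
  have b3: "mollify \<sigma> (?h n) x = expint (\<lambda>k. \<phi> n k * complex_of_real (gauss \<sigma> k)) (- x)" for n
  proof -
    have "mollify \<sigma> (?h n) x = mollify \<sigma> (expint (\<phi> n)) (- x)"
      unfolding mollify_def
      by (subst lborel_integral_real_affine[where c="-1" and t=0])
         (simp_all add: fourier_integral_eq_expint normal_density_def power2_commute)
    also have "\<dots> = expint (\<lambda>k. \<phi> n k * complex_of_real (gauss \<sigma> k)) (- x)"
      by (rule mollify_expint[OF int \<sigma>])
    finally show ?thesis .
  qed
  show "mollify \<sigma> g x = expint (\<lambda>k. f k * complex_of_real (gauss \<sigma> k)) (- x)"
    using LIMSEQ_unique[OF b1] b2 unfolding b3 by blast
qed

section \<open>Uniqueness of the Fourier transform up to null sets\<close>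

lemma norm_diff_square_le:
  fixes a b c d :: "'a :: real_normed_vector"
  shows "(norm (a - d))\<^sup>2 \<le> 3 * ((norm (a - b))\<^sup>2 + (norm (b - c))\<^sup>2 + (norm (c - d))\<^sup>2)"
proof -
  have "norm (a - d) \<le> norm (a - b) + norm (b - c) + norm (c - d)"
    using norm_triangle_ineq[of "a - b" "b - d"] norm_triangle_ineq[of "b - c" "c - d"] by simp
  hence "(norm (a - d))\<^sup>2 \<le> (norm (a - b) + norm (b - c) + norm (c - d))\<^sup>2"
    by (intro power_mono) auto
  also have "\<dots> \<le> 3 * ((norm (a - b))\<^sup>2 + (norm (b - c))\<^sup>2 + (norm (c - d))\<^sup>2)"
    using sum_squares_bound[of "norm (a - b)" "norm (b - c)"] sum_squares_bound[of "norm (a - b)" "norm (c - d)"]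
      sum_squares_bound[of "norm (b - c)" "norm (c - d)"]
    by (simp add: power2_eq_square algebra_simps)
  finally show ?thesis .
qed

text \<open>A triangle inequality for squared distances along three steps; the factor 3 is harmless
  because it multiplies quantities that tend to 0.\<close>

lemma nn_integral_norm_diff_square_le:
  fixes a b c d :: "real \<Rightarrow> complex"
  assumes [measurable]: "a \<in> borel_measurable borel" "b \<in> borel_measurable borel"
    "c \<in> borel_measurable borel" "d \<in> borel_measurable borel"
  shows "(\<integral>\<^sup>+x. ennreal ((norm (a x - d x))\<^sup>2) \<partial>lborel) \<le>
     3 * ((\<integral>\<^sup>+x. ennreal ((norm (a x - b x))\<^sup>2) \<partial>lborel) + (\<integral>\<^sup>+x. ennreal ((norm (b x - c x))\<^sup>2) \<partial>lborel)
       + (\<integral>\<^sup>+x. ennreal ((norm (c x - d x))\<^sup>2) \<partial>lborel))"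
proof -
  have "(\<integral>\<^sup>+x. ennreal ((norm (a x - d x))\<^sup>2) \<partial>lborel) \<le>
      (\<integral>\<^sup>+x. 3 * (ennreal ((norm (a x - b x))\<^sup>2) + ennreal ((norm (b x - c x))\<^sup>2) + ennreal ((norm (c x - d x))\<^sup>2)) \<partial>lborel)"
  proof (rule nn_integral_mono)
    fix x
    have "ennreal ((norm (a x - d x))\<^sup>2) \<le> ennreal (3 * ((norm (a x - b x))\<^sup>2 + (norm (b x - c x))\<^sup>2 + (norm (c x - d x))\<^sup>2))"
      by (intro ennreal_leI norm_diff_square_le)
    thus "ennreal ((norm (a x - d x))\<^sup>2) \<le> 3 * (ennreal ((norm (a x - b x))\<^sup>2) + ennreal ((norm (b x - c x))\<^sup>2) + ennreal ((norm (c x - d x))\<^sup>2))"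
      by (simp add: ennreal_mult)
  qed
  also have "\<dots> = 3 * ((\<integral>\<^sup>+x. ennreal ((norm (a x - b x))\<^sup>2) \<partial>lborel) + (\<integral>\<^sup>+x. ennreal ((norm (b x - c x))\<^sup>2) \<partial>lborel)
       + (\<integral>\<^sup>+x. ennreal ((norm (c x - d x))\<^sup>2) \<partial>lborel))"
    by (simp add: nn_integral_cmult nn_integral_add)
  finally show ?thesis .
qed

lemma nn_integral_reflect:
  assumes "f \<in> borel_measurable borel"
  shows "(\<integral>\<^sup>+x. f (- x) \<partial>lborel) = (\<integral>\<^sup>+x. f (x::real) \<partial>lborel)"
  using nn_integral_real_affine[OF assms, of "-1" 0] by simp

text \<open>The path leads from \<open>g\<close> through the transforms of two approximating
  sequences to \<open>h\<close>. Its middle step is Plancherel for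
  \<open>\<phi> n - \<psi> n\<close>, which tends to 0 because both sequences approach
  \<open>f\<close>. The lemma carries the moment bound in \<open>fourier_sobolev\<close> from one
  representative to any other.\<close>

lemma fourier_transform_unique:
  assumes g: "has_fourier_transform f g" and h: "has_fourier_transform f h"
  shows "AE k in lborel. g k = h k"
proof -
  from g obtain \<phi> where \<phi>: "\<And>n. schwartz (\<phi> n)" and l1: "L2_tendsto \<phi> f"
    and l2: "L2_tendsto (\<lambda>n. fourier_integral (\<phi> n)) g"
    and f: "f \<in> L2_on UNIV" and g: "g \<in> L2_on UNIV"
    unfolding has_fourier_transform_def by blast
  from h obtain \<psi> where \<psi>: "\<And>n. schwartz (\<psi> n)" and m1: "L2_tendsto \<psi> f"
    and m2: "L2_tendsto (\<lambda>n. fourier_integral (\<psi> n)) h"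
    and h: "h \<in> L2_on UNIV"
    unfolding has_fourier_transform_def by blast
  note [measurable] = L2_onD(1)[OF f] L2_onD(1)[OF g] L2_onD(1)[OF h]
    borel_measurable_integrable[OF schwartz_integrable[OF \<phi>]]
    borel_measurable_integrable[OF schwartz_integrable[OF \<psi>]]
  have [measurable]: "fourier_integral (\<phi> n) \<in> borel_measurable borel" "fourier_integral (\<psi> n) \<in> borel_measurable borel" for n
    unfolding fourier_integral_eq_expint[abs_def] by measurable
  let ?D = "\<lambda>u v. \<integral>\<^sup>+x. ennreal ((norm (u x - v x))\<^sup>2) \<partial>lborel"
  have D_sym: "?D u v = ?D v u" for u v :: "real \<Rightarrow> complex"
    by (simp add: norm_minus_commute)
  have planch: "?D (fourier_integral (\<phi> n)) (fourier_integral (\<psi> n)) \<le> ?D (\<phi> n) (\<psi> n)" for n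
  proof -
    note int = schwartz_integrable[OF \<phi>, of n] schwartz_integrable[OF \<psi>, of n]
    have "fourier_integral (\<phi> n) k - fourier_integral (\<psi> n) k = expint (\<lambda>x. \<phi> n x - \<psi> n x) (- k)" for k
      unfolding fourier_integral_eq_expint
      using integrable_mult_iexp[OF int(1), of "- k"] integrable_mult_iexp[OF int(2), of "- k"]
      by (simp add: expint_def left_diff_distrib diff_divide_distrib)
    hence "?D (fourier_integral (\<phi> n)) (fourier_integral (\<psi> n))
        = (\<integral>\<^sup>+k. ennreal ((norm (expint (\<lambda>x. \<phi> n x - \<psi> n x) (- k)))\<^sup>2) \<partial>lborel)"
      by simp
    also have "\<dots> = (\<integral>\<^sup>+k. ennreal ((norm (expint (\<lambda>x. \<phi> n x - \<psi> n x) k))\<^sup>2) \<partial>lborel)"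
      by (rule nn_integral_reflect) measurable
    also have "\<dots> \<le> ?D (\<phi> n) (\<psi> n)"
      by (rule plancherel_le) (use int in simp)
    finally show ?thesis .
  qed
  \<comment> \<open>The inner 0 is \<open>?D f f\<close>: the three-step estimate is used a second
    time for the path from \<open>\<phi> n\<close> over \<open>f\<close> to
    \<open>\<psi> n\<close>.\<close>
  let ?b = "\<lambda>n. 3 * (?D (fourier_integral (\<phi> n)) g + 3 * (?D (\<phi> n) f + 0 + ?D (\<psi> n) f) + ?D (fourier_integral (\<psi> n)) h)"
  have le: "?D g h \<le> ?b n" for n
  proof -
    have "?D (\<phi> n) (\<psi> n) \<le> 3 * (?D (\<phi> n) f + ?D f f + ?D f (\<psi> n))"
      by (rule nn_integral_norm_diff_square_le) measurable
    hence "?D (\<phi> n) (\<psi> n) \<le> 3 * (?D (\<phi> n) f + 0 + ?D (\<psi> n) f)"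
      using D_sym[of "\<psi> n" f] by simp
    with planch[of n] have *: "?D (fourier_integral (\<phi> n)) (fourier_integral (\<psi> n)) \<le> 3 * (?D (\<phi> n) f + 0 + ?D (\<psi> n) f)"
      by (rule order_trans)
    have "?D g h \<le> 3 * (?D g (fourier_integral (\<phi> n)) + ?D (fourier_integral (\<phi> n)) (fourier_integral (\<psi> n)) + ?D (fourier_integral (\<psi> n)) h)"
      by (rule nn_integral_norm_diff_square_le) measurable
    also have "\<dots> \<le> ?b n"
      unfolding D_sym[of g] by (intro mult_left_mono add_mono order_refl *) simp
    finally show ?thesis .
  qed
  have "?b \<longlonglongrightarrow> 3 * (0 + 3 * (0 + 0 + 0) + 0)"
    using l1 l2 m1 m2 unfolding L2_tendsto_def
    by (intro tendsto_intros ennreal_tendsto_cmult) auto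
  hence "?b \<longlonglongrightarrow> 0" by simp
  hence "?D g h \<le> 0"
    by (rule LIMSEQ_le_const) (use le in auto)
  hence "?D g h = 0" by simp
  hence "AE k in lborel. ennreal ((norm (g k - h k))\<^sup>2) = 0"
    by (subst (asm) nn_integral_0_iff_AE) measurable
  thus ?thesis by (auto elim!: eventually_mono)
qed

section \<open>Mollification and smoothness\<close>

text \<open>At distance at least 1 from the centre the exponential loss of the narrower Gaussian
  outweighs the factor \<open>m\<close> gained by its peak. The density of width 1 is thus a common
  majorant there.\<close>

lemma normal_density_inverse_le:
  assumes m: "m \<ge> 1" and d: "\<bar>y - x\<bar> \<ge> 1"
  shows "normal_density x (1 / m) y \<le> normal_density x 1 y"
proof -
  define d2 where "d2 = (y - x)\<^sup>2"
  have d2: "d2 \<ge> 1"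
    unfolding d2_def using d by (metis one_le_power power2_abs)
  \<comment> \<open>This is \<open>(m - 1)^2 >= 0\<close>; the chain bounds \<open>m\<close> by
    exactly the exponential that the narrower Gaussian loses.\<close>
  have "m \<le> 1 + (m\<^sup>2 - 1) / 2 * 1"
    using zero_le_power2[of "m - 1"] by (simp add: power2_eq_square field_simps)
  also have "\<dots> \<le> 1 + (m\<^sup>2 - 1) / 2 * d2"
    using m d2 by (intro add_left_mono mult_left_mono) auto
  also have "\<dots> \<le> exp ((m\<^sup>2 - 1) / 2 * d2)"
    by (rule exp_ge_add_one_self)
  finally have "m * exp (- (m\<^sup>2 / 2 * d2)) \<le> exp ((m\<^sup>2 - 1) / 2 * d2) * exp (- (m\<^sup>2 / 2 * d2))"
    by (rule mult_right_mono) simp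
  hence "m * exp (- (m\<^sup>2 / 2 * d2)) \<le> exp (- d2 / 2)"
    by (simp add: exp_add[symmetric] algebra_simps diff_divide_distrib)
  hence "m * exp (- (m\<^sup>2 / 2 * d2)) / sqrt (2 * pi) \<le> exp (- d2 / 2) / sqrt (2 * pi)"
    by (rule divide_right_mono) simp
  thus ?thesis
    using m by (simp add: normal_density_def d2_def power_divide real_sqrt_divide algebra_simps)
qed

text \<open>From \<open>t <= exp t\<close> with \<open>t = m^2 * D\<close>, where \<open>m\<close>
  is the reciprocal width: the decay beats the peak and leaves a bound of order
  \<open>1 / m\<close>.\<close>

lemma normal_density_inverse_tendsto_0:
  assumes "y \<noteq> x"
  shows "(\<lambda>n. normal_density x (1 / real (Suc n)) y) \<longlonglongrightarrow> 0"
proof -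
  define D where "D = (y - x)\<^sup>2 / 2"
  have D: "D > 0" using assms by (simp add: D_def)
  have "(\<lambda>n. 1 / D * (1 / real (Suc n))) \<longlonglongrightarrow> 1 / D * 0"
    by (intro tendsto_mult tendsto_const LIMSEQ_Suc lim_1_over_n)
  hence lim: "(\<lambda>n. 1 / D * (1 / real (Suc n))) \<longlonglongrightarrow> 0" by simp
  have bound: "normal_density x (1 / real (Suc n)) y \<le> 1 / D * (1 / real (Suc n))" for n
  proof -
    define m where "m = real (Suc n)"
    have m: "m > 0" by (simp add: m_def)
    have "m\<^sup>2 * D \<le> exp (m\<^sup>2 * D)"
      using exp_ge_add_one_self[of "m\<^sup>2 * D"] by linarith
    hence "m * exp (- (m\<^sup>2 * D)) \<le> 1 / D * (1 / m)"
      using m D by (simp add: exp_minus divide_simps power2_eq_square mult_ac)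
    moreover have "normal_density x (1 / m) y = m * exp (- (m\<^sup>2 * D)) / sqrt (2 * pi)"
      using m by (simp add: normal_density_def D_def power_divide real_sqrt_divide algebra_simps)
    moreover have "m * exp (- (m\<^sup>2 * D)) / sqrt (2 * pi) \<le> m * exp (- (m\<^sup>2 * D)) / 1"
      using m pi_ge_two by (intro divide_left_mono) auto
    ultimately show ?thesis by (simp add: m_def)
  qed
  show ?thesis
    by (rule tendsto_sandwich[OF _ _ tendsto_const lim]) (use bound in auto)
qed

text \<open>\<open>f\<close> may be unbounded, so rescaling with a constant majorant works only
  close to \<open>x\<close>. The part within distance 1 is bounded by compactness and is rescaled;
  the rest is dominated by \<open>|f|\<close> times the density of width 1.\<close>

lemma mollify_tendsto:
  assumes f: "f \<in> L2_on UNIV" and cont: "continuous_on UNIV f"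
  shows "(\<lambda>n. mollify (1 / real (Suc n)) f x) \<longlonglongrightarrow> f x"
proof -
  let ?\<sigma> = "\<lambda>n. 1 / real (Suc n)"
  let ?I = "{x - 1..x + 1}"
  let ?d = "\<lambda>n y. complex_of_real (normal_density x (?\<sigma> n) y)"
  define near where "near = (\<lambda>y. indicator ?I y *\<^sub>R f y)"
  define far where "far = (\<lambda>y. indicator (- ?I) y *\<^sub>R f y)"
  note [measurable] = L2_onD(1)[OF f]
  have [measurable]: "near \<in> borel_measurable borel" "far \<in> borel_measurable borel"
    unfolding near_def far_def by measurable
  have int: "integrable lborel (\<lambda>y. f y * ?d n y)" for n
    by (rule integrable_mult_L2[OF f normal_density_L2]) simp
  have near_int: "integrable lborel (\<lambda>y. near y * ?d n y)" for n
    by (rule Bochner_Integration.integrable_bound[OF int[of n]])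
       (auto simp: near_def norm_mult indicator_def)
  have far_int: "integrable lborel (\<lambda>y. far y * ?d n y)" for n
    by (rule Bochner_Integration.integrable_bound[OF int[of n]])
       (auto simp: far_def norm_mult indicator_def)
  have split: "mollify (?\<sigma> n) f x = (\<integral>y. near y * ?d n y \<partial>lborel) + (\<integral>y. far y * ?d n y \<partial>lborel)" for n
    unfolding mollify_def Bochner_Integration.integral_add[OF near_int far_int, symmetric]
    by (rule Bochner_Integration.integral_cong) (auto simp: near_def far_def indicator_def)
  have "(\<lambda>n. \<integral>y. far y * ?d n y \<partial>lborel) \<longlonglongrightarrow> (\<integral>y. 0 \<partial>(lborel :: real measure))"
  proof (rule integral_dominated_convergence)
    \<comment> \<open>Index 0 is the width 1, the majorant of
      \<open>normal_density_inverse_le\<close>.\<close>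
    show "integrable lborel (\<lambda>y. norm (f y * ?d 0 y))"
      by (rule integrable_norm[OF int])
    show "AE y in lborel. (\<lambda>n. far y * ?d n y) \<longlonglongrightarrow> 0"
    proof (rule AE_I2)
      fix y
      show "(\<lambda>n. far y * ?d n y) \<longlonglongrightarrow> 0"
      proof (cases "y \<in> ?I")
        case False
        hence "(\<lambda>n. far y * ?d n y) \<longlonglongrightarrow> far y * complex_of_real 0"
          by (intro tendsto_mult tendsto_const tendsto_of_real normal_density_inverse_tendsto_0) auto
        thus ?thesis by simp
      qed (simp add: far_def)
    qed
    show "AE y in lborel. norm (far y * ?d n y) \<le> norm (f y * ?d 0 y)" for n
    proof (rule AE_I2)
      fix y
      show "norm (far y * ?d n y) \<le> norm (f y * ?d 0 y)"
      proof (cases "y \<in> ?I")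
        case False
        hence "normal_density x (?\<sigma> n) y \<le> normal_density x 1 y"
          by (intro normal_density_inverse_le) auto
        thus ?thesis
          using False by (auto simp: far_def norm_mult intro!: mult_left_mono)
      qed (simp add: far_def)
    qed
  qed measurable
  hence far_lim: "(\<lambda>n. \<integral>y. far y * ?d n y \<partial>lborel) \<longlonglongrightarrow> 0" by simp
  \<comment> \<open>Rescaling fixes the density and moves the width into the argument of
    \<open>near\<close>, where continuity of \<open>f\<close> at \<open>x\<close> applies.\<close>
  have near_eq: "(\<integral>y. near y * ?d n y \<partial>lborel) = (\<integral>z. near (x + ?\<sigma> n * z) * complex_of_real (std_normal_density z) \<partial>lborel)" for n
  proof -
    let ?s = "?\<sigma> n"
    have s: "?s > 0" by simp
    have key: "complex_of_real ?s * ?d n (x + ?s * z) = complex_of_real (std_normal_density z)" for z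
    proof -
      have "?s * normal_density x ?s (x + ?s * z) = std_normal_density z"
        using s by (simp add: normal_density_def power_mult_distrib power_divide real_sqrt_divide del: of_nat_Suc)
      thus ?thesis by (metis of_real_mult)
    qed
    have *: "?s *\<^sub>R (near (x + ?s * z) * ?d n (x + ?s * z)) = near (x + ?s * z) * complex_of_real (std_normal_density z)" for z
      unfolding scaleR_conv_of_real key[symmetric] by (rule mult.left_commute)
    have "(\<integral>y. near y * ?d n y \<partial>lborel) = ?s *\<^sub>R (\<integral>z. near (x + ?s * z) * ?d n (x + ?s * z) \<partial>lborel)"
      using s by (subst lborel_integral_real_affine[where c="?s" and t=x]) auto
    also have "\<dots> = (\<integral>z. ?s *\<^sub>R (near (x + ?s * z) * ?d n (x + ?s * z)) \<partial>lborel)"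
      by (rule integral_scaleR_right[symmetric])
    finally show ?thesis by (simp only: *)
  qed
  have "bounded (f ` ?I)"
    by (intro compact_imp_bounded compact_continuous_image continuous_on_subset[OF cont]) auto
  then obtain B where B: "\<And>y. y \<in> ?I \<Longrightarrow> norm (f y) \<le> B"
    unfolding bounded_iff by (metis imageI)
  have B0: "B \<ge> 0" using order_trans[OF norm_ge_zero B[of x]] by simp
  have near_le: "norm (near y) \<le> B" for y
    using B[of y] B0 by (auto simp: near_def indicator_def)
  have "(\<lambda>n. \<integral>z. near (x + ?\<sigma> n * z) * complex_of_real (std_normal_density z) \<partial>lborel)
      \<longlonglongrightarrow> (\<integral>z. f x * complex_of_real (std_normal_density z) \<partial>lborel)"
  proof (rule integral_dominated_convergence)
    show "integrable lborel (\<lambda>z. B * std_normal_density z)" by simp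
    show "AE z in lborel. norm (near (x + ?\<sigma> n * z) * complex_of_real (std_normal_density z)) \<le> B * std_normal_density z" for n
      using near_le by (auto simp: norm_mult intro!: mult_right_mono)
    show "AE z in lborel. (\<lambda>n. near (x + ?\<sigma> n * z) * complex_of_real (std_normal_density z))
        \<longlonglongrightarrow> f x * complex_of_real (std_normal_density z)"
    proof (rule AE_I2, intro tendsto_mult tendsto_const)
      fix z
      have "(\<lambda>n. x + ?\<sigma> n * z) \<longlonglongrightarrow> x + 0 * z"
        by (intro tendsto_intros LIMSEQ_Suc lim_1_over_n)
      hence lim: "(\<lambda>n. x + ?\<sigma> n * z) \<longlonglongrightarrow> x" by simp
      have "(\<lambda>n. f (x + ?\<sigma> n * z)) \<longlonglongrightarrow> f x"
        by (rule isCont_tendsto_compose[OF _ lim]) (use cont in \<open>simp add: continuous_on_eq_continuous_at\<close>)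
      moreover have "eventually (\<lambda>n. x + ?\<sigma> n * z \<in> {x - 1<..<x + 1}) sequentially"
        by (rule topological_tendstoD[OF lim]) auto
      hence "eventually (\<lambda>n. f (x + ?\<sigma> n * z) = near (x + ?\<sigma> n * z)) sequentially"
        by (rule eventually_mono) (auto simp: near_def)
      ultimately show "(\<lambda>n. near (x + ?\<sigma> n * z)) \<longlonglongrightarrow> f x"
        by (rule Lim_transform_eventually)
    qed
  qed measurable
  also have "(\<integral>z. f x * complex_of_real (std_normal_density z) \<partial>lborel) = f x"
    by simp
  finally show ?thesis
    unfolding split near_eq using far_lim tendsto_add by fastforce
qed

section \<open>Differentiation under the Fourier integral\<close>

lemma continuous_expint:
  assumes u: "integrable lborel u"
  shows "continuous_on UNIV (expint u)"
proof -
  have "(\<lambda>n. expint u (X n)) \<longlonglongrightarrow> expint u x" if "X \<longlonglongrightarrow> x" for X x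
  proof -
    note [measurable] = borel_measurable_integrable[OF u]
    have "(\<lambda>n. \<integral>k. u k * iexp (k * X n) \<partial>lborel) \<longlonglongrightarrow> (\<integral>k. u k * iexp (k * x) \<partial>lborel)"
      by (rule integral_dominated_convergence[OF _ _ integrable_norm[OF u]])
         (auto simp: norm_mult intro!: tendsto_intros that)
    thus ?thesis unfolding expint_def by (intro tendsto_divide tendsto_const) auto
  qed
  thus ?thesis
    by (simp add: continuous_on_sequentially o_def)
qed

lemma norm_iexp_diff_le: "norm (iexp a - iexp b) \<le> \<bar>a - b\<bar>"
proof -
  have "iexp a - iexp b = iexp b * (iexp (a - b) - 1)"
    by (simp add: algebra_simps flip: exp_add)
  thus ?thesis
    using iexp_approx1[of "a - b" 0] by (simp add: norm_mult)
qed

text \<open>Dominated convergence for the remainder quotient \<open>?q\<close>: its modulus is at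
  most \<open>2 * |k|\<close>, one \<open>|k|\<close> from the difference and one from the linear
  term, so \<open>2 * |k * u k|\<close> is an integrable majorant.\<close>

lemma expint_has_vector_derivative:
  assumes u: "integrable lborel u" and ku: "integrable lborel (\<lambda>k. complex_of_real k * u k)"
  shows "(expint u has_vector_derivative expint (\<lambda>k. \<i> * (complex_of_real k * u k)) x) (at x)"
proof -
  note [measurable] = borel_measurable_integrable[OF u]
  let ?s = "complex_of_real (sqrt (2 * pi))"
  let ?q = "\<lambda>y k. (iexp (k * y) - iexp (k * x) - (y - x) *\<^sub>R (\<i> * complex_of_real k * iexp (k * x))) /\<^sub>R norm (y - x)"
  have q_le: "norm (?q y k) \<le> 2 * \<bar>k\<bar>" if "y \<noteq> x" for y k
  proof -
    have "norm (iexp (k * y) - iexp (k * x) - (y - x) *\<^sub>R (\<i> * complex_of_real k * iexp (k * x)))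
        \<le> norm (iexp (k * y) - iexp (k * x)) + norm ((y - x) *\<^sub>R (\<i> * complex_of_real k * iexp (k * x)))"
      by (rule norm_triangle_ineq4)
    also have "\<dots> \<le> \<bar>k * y - k * x\<bar> + \<bar>y - x\<bar> * \<bar>k\<bar>"
      by (intro add_mono norm_iexp_diff_le) (simp add: norm_mult)
    also have "\<dots> = \<bar>y - x\<bar> * (2 * \<bar>k\<bar>)"
      by (simp add: right_diff_distrib[symmetric] abs_mult)
    finally show ?thesis
      using that by (simp add: divide_simps mult_ac)
  qed
  have "((\<lambda>y. ((expint u y - expint u x) - (y - x) *\<^sub>R expint (\<lambda>k. \<i> * (complex_of_real k * u k)) x) /\<^sub>R norm (y - x)) \<longlongrightarrow> 0) (at x)"
    unfolding tendsto_at_iff_sequentially comp_def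
  proof (intro allI impI)
    fix X :: "nat \<Rightarrow> real"
    assume "\<forall>i. X i \<in> UNIV - {x}" and X: "X \<longlonglongrightarrow> x"
    hence X_ne: "X i \<noteq> x" for i by auto
    have eq: "((expint u (X n) - expint u x) - (X n - x) *\<^sub>R expint (\<lambda>k. \<i> * (complex_of_real k * u k)) x) /\<^sub>R norm (X n - x)
        = (\<integral>k. u k * ?q (X n) k \<partial>lborel) / ?s" for n
    proof -
      have "(\<integral>k. u k * ?q (X n) k \<partial>lborel)
          = (\<integral>k. (u k * iexp (k * X n) - u k * iexp (k * x) - (X n - x) *\<^sub>R (\<i> * (complex_of_real k * u k) * iexp (k * x))) /\<^sub>R norm (X n - x) \<partial>lborel)"
        by (rule Bochner_Integration.integral_cong) (simp_all add: scaleR_conv_of_real algebra_simps)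
      also have "\<dots> = ((\<integral>k. u k * iexp (k * X n) \<partial>lborel) - (\<integral>k. u k * iexp (k * x) \<partial>lborel)
          - (X n - x) *\<^sub>R (\<integral>k. \<i> * (complex_of_real k * u k) * iexp (k * x) \<partial>lborel)) /\<^sub>R norm (X n - x)"
        using integrable_mult_iexp[OF u, of "X n"] integrable_mult_iexp[OF u, of x]
          integrable_mult_iexp[OF integrable_mult_right[OF ku, of \<i>], of x]
        by (simp only: integral_scaleR_right Bochner_Integration.integral_diff
            Bochner_Integration.integrable_diff integrable_scaleR_right)
      finally show ?thesis
        unfolding expint_def scaleR_conv_of_real
        by (simp only: times_divide_eq_right diff_divide_distrib[symmetric])
    qed
    have "(\<lambda>n. \<integral>k. u k * ?q (X n) k \<partial>lborel) \<longlonglongrightarrow> (\<integral>k. 0 \<partial>(lborel :: real measure))"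
    proof (rule integral_dominated_convergence)
      show "integrable lborel (\<lambda>k. 2 * norm (complex_of_real k * u k))"
        using integrable_norm[OF ku] by simp
      show "AE k in lborel. norm (u k * ?q (X n) k) \<le> 2 * norm (complex_of_real k * u k)" for n
      proof (rule AE_I2)
        fix k
        have "norm (u k) * norm (?q (X n) k) \<le> norm (u k) * (2 * \<bar>k\<bar>)"
          by (intro mult_left_mono q_le X_ne) simp
        thus "norm (u k * ?q (X n) k) \<le> 2 * norm (complex_of_real k * u k)"
          by (simp only: norm_mult norm_of_real mult_ac)
      qed
      show "AE k in lborel. (\<lambda>n. u k * ?q (X n) k) \<longlonglongrightarrow> 0"
      proof (rule AE_I2)
        fix k
        have "((\<lambda>y. iexp (k * y)) has_vector_derivative (\<i> * complex_of_real k * iexp (k * x))) (at x)"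
          by (auto intro!: derivative_eq_intros has_vector_derivative_real_field simp: algebra_simps)
        hence "((\<lambda>y. ?q y k) \<longlongrightarrow> 0) (at x)"
          unfolding has_vector_derivative_def has_derivative_def by simp
        hence "(\<lambda>n. ?q (X n) k) \<longlonglongrightarrow> 0"
          using X X_ne unfolding tendsto_at_iff_sequentially comp_def by blast
        thus "(\<lambda>n. u k * ?q (X n) k) \<longlonglongrightarrow> 0"
          by (rule tendsto_mult_right_zero)
      qed
    qed measurable
    hence "(\<lambda>n. (\<integral>k. u k * ?q (X n) k \<partial>lborel) / ?s) \<longlonglongrightarrow> 0 / ?s"
      by (intro tendsto_divide tendsto_const) auto
    thus "(\<lambda>n. ((expint u (X n) - expint u x) - (X n - x) *\<^sub>R expint (\<lambda>k. \<i> * (complex_of_real k * u k)) x) /\<^sub>R norm (X n - x)) \<longlonglongrightarrow> 0"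
      unfolding eq by simp
  qed
  thus ?thesis
    unfolding has_vector_derivative_def has_derivative_def
    by (simp add: bounded_linear_scaleR_left)
qed

section \<open>Dirichlet bounds on an interval\<close>

lemma set_integrable_Ioo_continuous:
  fixes h :: "real \<Rightarrow> 'a :: {banach, second_countable_topology}"
  assumes "continuous_on {a..b} h"
  shows "set_integrable lborel {a<..<b} h"
  by (rule set_integrable_subset[OF borel_integrable_atLeastAtMost'[OF assms]]) auto

lemma LBINT_Ioo_FTC:
  fixes F F' :: "real \<Rightarrow> 'a :: euclidean_space"
  assumes "a \<le> b" and "continuous_on {a..b} F'"
    and "\<And>x. x \<in> {a..b} \<Longrightarrow> (F has_vector_derivative F' x) (at x within {a..b})"
  shows "(LBINT x:{a<..<b}. F' x) = F b - F a"
  using interval_integral_FTC_finite[of a b F' F] assms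
  by (simp add: interval_lebesgue_integral_def)

text \<open>Taken on the whole line because the functions arise as \<open>expint\<close> of a
  weighted \<open>g\<close>; vanishing at endpoints is imposed separately on each interval.\<close>

definition C1_on_line :: "(real \<Rightarrow> complex) \<Rightarrow> (real \<Rightarrow> complex) \<Rightarrow> bool" where
  "C1_on_line u u' \<longleftrightarrow> (\<forall>x. (u has_vector_derivative u' x) (at x)) \<and> continuous_on UNIV u'"

lemma C1_on_lineD:
  assumes "C1_on_line u u'"
  shows "(u has_vector_derivative u' x) (at x within S)"
    and "continuous_on S u" and "continuous_on S u'"
proof -
  have d: "(u has_vector_derivative u' x) (at x)" for x
    using assms by (simp add: C1_on_line_def)
  show "(u has_vector_derivative u' x) (at x within S)"
    using d by (rule has_vector_derivative_at_within)
  show "continuous_on S u"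
    using d has_vector_derivative_continuous by (blast intro: continuous_at_imp_continuous_on)
  show "continuous_on S u'"
    using assms by (auto simp: C1_on_line_def intro: continuous_on_subset)
qed

text \<open>
  For \<open>T x = \<omega> tan (\<omega> (x - (a + b) / 2))\<close>, which is regular on \<open>[a, b]\<close> and satisfies
  \<open>T' = \<omega>\<^sup>2 + T\<^sup>2\<close>, one has \<open>|u' + T u|\<^sup>2 = |u'|\<^sup>2 - \<omega>\<^sup>2 |u|\<^sup>2 + (T |u|\<^sup>2)'\<close>.
\<close>

lemma wirtinger_inequality:
  assumes u: "C1_on_line u u'" and ends: "u a = 0" "u b = 0"
    and ab: "a < b" and \<omega>: "0 \<le> \<omega>" "\<omega> * (b - a) < pi"
  shows "\<omega>\<^sup>2 * (LBINT x:{a<..<b}. (norm (u x))\<^sup>2) \<le> (LBINT x:{a<..<b}. (norm (u' x))\<^sup>2)"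
proof -
  define \<theta> where "\<theta> x = \<omega> * (x - (a + b) / 2)" for x
  define T where "T x = \<omega> * tan (\<theta> x)" for x
  define F where "F x = T x * (u x \<bullet> u x)" for x
  define F' where "F' x = (\<omega>\<^sup>2 + (T x)\<^sup>2) * (u x \<bullet> u x) + T x * (2 * (u x \<bullet> u' x))" for x
  have cos: "cos (\<theta> x) \<noteq> 0" if "x \<in> {a..b}" for x
  proof -
    have "\<omega> * \<bar>x - (a + b) / 2\<bar> \<le> \<omega> * ((b - a) / 2)"
      using that \<omega> by (intro mult_left_mono) (auto simp: abs_le_iff field_simps)
    hence "\<bar>\<theta> x\<bar> < pi / 2"
      using \<omega> by (simp add: \<theta>_def abs_mult)
    hence "0 < cos (\<theta> x)"
      unfolding abs_less_iff by (intro cos_gt_zero_pi) linarith+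
    thus ?thesis by simp
  qed
  have contT: "continuous_on {a..b} T"
    unfolding T_def using cos by (auto simp: \<theta>_def intro!: continuous_intros)
  note cont = C1_on_lineD(2)[OF u, of "{a..b}"] C1_on_lineD(3)[OF u, of "{a..b}"]
  have contF': "continuous_on {a..b} F'"
    unfolding F'_def by (intro continuous_intros contT cont)
  have T': "(T has_real_derivative \<omega>\<^sup>2 + (T x)\<^sup>2) (at x within {a..b})" if "x \<in> {a..b}" for x
  proof -
    have "(T has_real_derivative \<omega> * (inverse ((cos (\<theta> x))\<^sup>2) * \<omega>)) (at x within {a..b})"
      unfolding T_def \<theta>_def using cos[OF that]
      by (auto intro!: derivative_eq_intros simp: \<theta>_def)
    moreover have "\<omega> * (inverse ((cos (\<theta> x))\<^sup>2) * \<omega>) = \<omega>\<^sup>2 + (T x)\<^sup>2"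
      unfolding T_def power_inverse[symmetric] tan_sec[OF cos[OF that], symmetric]
      by (simp add: power2_eq_square algebra_simps)
    ultimately show ?thesis by simp
  qed
  have F_deriv: "(F has_vector_derivative F' x) (at x within {a..b})" if "x \<in> {a..b}" for x
  proof -
    have "((\<lambda>x. u x \<bullet> u x) has_vector_derivative (u x \<bullet> u' x + u' x \<bullet> u x)) (at x within {a..b})"
      using bounded_bilinear.has_vector_derivative[OF bounded_bilinear_inner C1_on_lineD(1)[OF u] C1_on_lineD(1)[OF u]] .
    hence "(F has_real_derivative (\<omega>\<^sup>2 + (T x)\<^sup>2) * (u x \<bullet> u x) + (u x \<bullet> u' x + u' x \<bullet> u x) * T x) (at x within {a..b})"
      unfolding F_def by (intro DERIV_mult T'[OF that]) (simp add: has_real_derivative_iff_has_vector_derivative)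
    thus ?thesis
      by (simp add: has_real_derivative_iff_has_vector_derivative F'_def inner_commute[of "u' x"] algebra_simps)
  qed
  have F'_int: "(LBINT x:{a<..<b}. F' x) = 0"
    using LBINT_Ioo_FTC[OF less_imp_le[OF ab] contF' F_deriv] ends by (simp add: F_def)
  have pointwise: "\<omega>\<^sup>2 * (norm (u x))\<^sup>2 - F' x \<le> (norm (u' x))\<^sup>2" for x
  proof -
    have "0 \<le> (u' x + T x *\<^sub>R u x) \<bullet> (u' x + T x *\<^sub>R u x)" by simp
    also have "\<dots> = u' x \<bullet> u' x + 2 * T x * (u x \<bullet> u' x) + (T x)\<^sup>2 * (u x \<bullet> u x)"
      by (simp add: inner_add_left inner_add_right inner_commute power2_eq_square)
    also have "\<dots> = (norm (u' x))\<^sup>2 + F' x - \<omega>\<^sup>2 * (norm (u x))\<^sup>2"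
      by (simp add: F'_def power2_norm_eq_inner algebra_simps)
    finally show ?thesis by simp
  qed
  have int: "set_integrable lborel {a<..<b} (\<lambda>x. (norm (u x))\<^sup>2)"
    "set_integrable lborel {a<..<b} (\<lambda>x. (norm (u' x))\<^sup>2)" "set_integrable lborel {a<..<b} F'"
    by (intro set_integrable_Ioo_continuous continuous_intros cont contF')+
  have "\<omega>\<^sup>2 * (LBINT x:{a<..<b}. (norm (u x))\<^sup>2) = (LBINT x:{a<..<b}. \<omega>\<^sup>2 * (norm (u x))\<^sup>2 - F' x)"
    using int F'_int by (simp add: set_integral_diff)
  also have "\<dots> \<le> (LBINT x:{a<..<b}. (norm (u' x))\<^sup>2)"
    using int by (intro set_integral_mono set_integral_diff set_integrable_mult_right pointwise) auto
  finally show ?thesis .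
qed

text \<open>The product of \<open>u\<close> with a test function has total increment 0, which is
  integration by parts for the weak derivative. This admits classical functions in the variational
  definitions of both eigenvalues.\<close>

lemma C1_on_line_H01:
  assumes u: "C1_on_line u u'" and ends: "u a = 0" "u b = 0" and ab: "a < b"
  shows "(u, u') \<in> H01 a b"
proof -
  note cont = C1_on_lineD(2,3)[OF u]
  have L2: "v \<in> L2_on {a<..<b}" if "continuous_on {a..b} v" for v
  proof -
    have "set_integrable lborel {a<..<b} v"
      by (rule set_integrable_Ioo_continuous[OF that])
    moreover have "set_integrable lborel {a<..<b} (\<lambda>x. (norm (v x))\<^sup>2)"
      by (intro set_integrable_Ioo_continuous continuous_intros that)
    ultimately show ?thesis
      unfolding L2_on_def set_borel_measurable_def set_integrable_def by simp
  qed
  have "has_weak_derivative u u' a b"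
    unfolding has_weak_derivative_def
  proof
    fix \<phi> assume "\<phi> \<in> test_functions a b"
    then obtain c d where smooth: "smooth \<phi>" and cd: "a < c" "d < b" "\<And>x. x \<notin> {c..d} \<Longrightarrow> \<phi> x = 0"
      unfolding test_functions_def by blast
    have "\<phi> differentiable at x" "vderiv \<phi> differentiable at x" for x
    proof -
      \<comment> \<open>Level 0 of \<open>smooth\<close> gives the derivative, level 1 its
        continuity.\<close>
      have "(vderiv ^^ 0) \<phi> differentiable at x" "(vderiv ^^ 1) \<phi> differentiable at x"
        using smooth unfolding smooth_def by blast+
      thus "\<phi> differentiable at x" "vderiv \<phi> differentiable at x" by simp_all
    qed
    hence \<phi>: "C1_on_line \<phi> (vderiv \<phi>)"
      unfolding C1_on_line_def vderiv_def
      by (auto simp: vector_derivative_works[symmetric] vderiv_def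
               intro!: continuous_at_imp_continuous_on differentiable_imp_continuous_within)
    note \<phi>_cont = C1_on_lineD(2,3)[OF \<phi>]
    have int: "set_integrable lborel {a<..<b} (\<lambda>x. u x * vderiv \<phi> x)"
      "set_integrable lborel {a<..<b} (\<lambda>x. u' x * \<phi> x)"
      by (intro set_integrable_Ioo_continuous continuous_intros cont \<phi>_cont)+
    have "(LBINT x:{a<..<b}. u x * vderiv \<phi> x + u' x * \<phi> x) = u b * \<phi> b - u a * \<phi> a"
      by (rule LBINT_Ioo_FTC)
         (use ab in \<open>auto intro!: continuous_intros cont \<phi>_cont
            has_vector_derivative_mult C1_on_lineD(1)[OF u] C1_on_lineD(1)[OF \<phi>]\<close>)
    thus "(LBINT x:{a<..<b}. u x * vderiv \<phi> x) = - (LBINT x:{a<..<b}. u' x * \<phi> x)"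
      using int ends by (simp add: set_integral_add eq_neg_iff_add_eq_0)
  qed
  thus ?thesis
    unfolding H01_def using L2[OF cont(1)] L2[OF cont(2)] cont(1) ends by blast
qed

section \<open>Dirichlet eigenvalues as lower bounds for Rayleigh quotients\<close>

lemma LBINT_norm_square_pos:
  assumes u: "C1_on_line u u'" and ne: "\<not> (AE x\<in>{a<..<b} in lborel. u x = 0)"
  shows "(LBINT x:{a<..<b}. (norm (u x))\<^sup>2) > 0"
proof -
  have int: "set_integrable lborel {a<..<b} (\<lambda>x. (norm (u x))\<^sup>2)"
    by (intro set_integrable_Ioo_continuous continuous_intros C1_on_lineD(2)[OF u])
  have "(LBINT x:{a<..<b}. (norm (u x))\<^sup>2) \<ge> 0"
    unfolding set_lebesgue_integral_def by (intro integral_nonneg_AE) auto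
  moreover have "(LBINT x:{a<..<b}. (norm (u x))\<^sup>2) \<noteq> 0"
  proof
    assume "(LBINT x:{a<..<b}. (norm (u x))\<^sup>2) = 0"
    hence "AE x in lborel. indicator {a<..<b} x *\<^sub>R (norm (u x))\<^sup>2 = 0"
      using int unfolding set_lebesgue_integral_def set_integrable_def
      by (subst (asm) integral_nonneg_eq_0_iff_AE) auto
    hence "AE x\<in>{a<..<b} in lborel. u x = 0"
      by (rule eventually_mono) (auto split: split_indicator_asm)
    with ne show False ..
  qed
  ultimately show ?thesis by simp
qed

lemma LBINT_Ioo_nonneg:
  fixes h :: "real \<Rightarrow> real"
  assumes "\<And>x. 0 \<le> h x"
  shows "0 \<le> (LBINT x:{a<..<b}. h x)"
  unfolding set_lebesgue_integral_def using assms by (intro integral_nonneg_AE) auto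

lemma sturm_liouville_eigenvalue_le:
  assumes u: "C1_on_line u u'" and ends: "u a = 0" "u b = 0" and ab: "a < b"
  shows "sturm_liouville_eigenvalue a b * (LBINT x:{a<..<b}. (norm (u x))\<^sup>2) \<le> (LBINT x:{a<..<b}. (norm (u' x))\<^sup>2)"
proof (cases "AE x\<in>{a<..<b} in lborel. u x = 0")
  case True
  hence "(LBINT x:{a<..<b}. (norm (u x))\<^sup>2) = 0"
    unfolding set_lebesgue_integral_def
    by (intro integral_eq_zero_AE) (erule eventually_mono, simp split: split_indicator)
  thus ?thesis by (simp add: LBINT_Ioo_nonneg)
next
  case False
  have "sturm_liouville_eigenvalue a b \<le> (LBINT x:{a<..<b}. (norm (u' x))\<^sup>2) / (LBINT x:{a<..<b}. (norm (u x))\<^sup>2)"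
    unfolding sturm_liouville_eigenvalue_def
  proof (rule cInf_lower)
    show "bdd_below {(LBINT x:{a<..<b}. (cmod (g' x))\<^sup>2) / (LBINT x:{a<..<b}. (cmod (g x))\<^sup>2)
          | g g'. (g, g') \<in> H01 a b \<and> \<not> (AE x\<in>{a<..<b} in lborel. g x = 0)}"
      by (rule bdd_belowI[of _ 0]) (auto intro!: divide_nonneg_nonneg LBINT_Ioo_nonneg)
  qed (use C1_on_line_H01[OF u ends ab] False in blast)
  thus ?thesis
    using LBINT_norm_square_pos[OF u False] by (simp add: field_simps)
qed

lemma ground_state_energy_le:
  assumes u: "C1_on_line u u'" and ends: "u a = 0" "u b = 0" and ab: "a < b"
  shows "ground_state_energy a b * (LBINT x:{a<..<b}. (norm (u x))\<^sup>2)
    \<le> 1/2 * (LBINT x:{a<..<b}. (norm (u' x))\<^sup>2 + x\<^sup>2 * (norm (u x))\<^sup>2)"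
proof (cases "AE x\<in>{a<..<b} in lborel. u x = 0")
  case True
  hence "(LBINT x:{a<..<b}. (norm (u x))\<^sup>2) = 0"
    unfolding set_lebesgue_integral_def
    by (intro integral_eq_zero_AE) (erule eventually_mono, simp split: split_indicator)
  thus ?thesis by (simp add: LBINT_Ioo_nonneg)
next
  case False
  have "ground_state_energy a b \<le> (1/2 * (LBINT x:{a<..<b}. (norm (u' x))\<^sup>2 + x\<^sup>2 * (norm (u x))\<^sup>2)) / (LBINT x:{a<..<b}. (norm (u x))\<^sup>2)"
    unfolding ground_state_energy_def
  proof (rule cInf_lower)
    show "bdd_below {(1/2 * (LBINT x:{a<..<b}. (cmod (g' x))\<^sup>2 + x\<^sup>2 * (cmod (g x))\<^sup>2)) /
            (LBINT x:{a<..<b}. (cmod (g x))\<^sup>2)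
          | g g'. (g, g') \<in> H01 a b \<and> \<not> (AE x\<in>{a<..<b} in lborel. g x = 0)}"
      by (rule bdd_belowI[of _ 0]) (auto intro!: divide_nonneg_nonneg mult_nonneg_nonneg LBINT_Ioo_nonneg)
  qed (use C1_on_line_H01[OF u ends ab] False in blast)
  thus ?thesis
    using LBINT_norm_square_pos[OF u False] by (simp add: field_simps)
qed

text \<open>The common consequence of the three conditions, each of which supplies one
  \<open>c > 1\<close> for all intervals. Only C1 functions are quantified over, since only
  mollifications with an affine correction are inserted.\<close>

definition hardy_gap :: "real \<Rightarrow> real \<Rightarrow> real \<Rightarrow> bool" where
  "hardy_gap c a b \<longleftrightarrow> (\<forall>u u'. C1_on_line u u' \<and> u a = 0 \<and> u b = 0 \<longrightarrow>
     c * (LBINT x:{a<..<b}. x\<^sup>2 * (norm (u x))\<^sup>2) \<le> (LBINT x:{a<..<b}. (norm (u' x))\<^sup>2))"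

lemma LBINT_weight_le:
  assumes u: "C1_on_line u u'"
  shows "(LBINT x:{a<..<b}. x\<^sup>2 * (norm (u x))\<^sup>2) \<le> (max \<bar>a\<bar> \<bar>b\<bar>)\<^sup>2 * (LBINT x:{a<..<b}. (norm (u x))\<^sup>2)"
proof -
  have int: "set_integrable lborel {a<..<b} (\<lambda>x. (norm (u x))\<^sup>2)"
    "set_integrable lborel {a<..<b} (\<lambda>x. x\<^sup>2 * (norm (u x))\<^sup>2)"
    by (intro set_integrable_Ioo_continuous continuous_intros C1_on_lineD(2)[OF u])+
  have "(LBINT x:{a<..<b}. x\<^sup>2 * (norm (u x))\<^sup>2) \<le> (LBINT x:{a<..<b}. (max \<bar>a\<bar> \<bar>b\<bar>)\<^sup>2 * (norm (u x))\<^sup>2)"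
    using int
  proof (intro set_integral_mono set_integrable_mult_right mult_right_mono)
    fix x assume "x \<in> {a<..<b}"
    hence "\<bar>x\<bar> \<le> max \<bar>a\<bar> \<bar>b\<bar>" by auto
    thus "x\<^sup>2 \<le> (max \<bar>a\<bar> \<bar>b\<bar>)\<^sup>2" by (metis abs_ge_zero power2_abs power_mono)
  qed auto
  thus ?thesis by simp
qed

text \<open>On the interval the weight is at most the square of the larger endpoint modulus, so an
  unweighted Dirichlet bound \<open>\<kappa>\<close> is traded for a weighted one. It serves both
  the Wirtinger bound and the Sturm-Liouville eigenvalue.\<close>

lemma hardy_gap_of_dirichlet_bound:
  assumes le: "\<And>u u'. C1_on_line u u' \<Longrightarrow> u a = 0 \<Longrightarrow> u b = 0 \<Longrightarrow>
      \<kappa> * (LBINT x:{a<..<b}. (norm (u x))\<^sup>2) \<le> (LBINT x:{a<..<b}. (norm (u' x))\<^sup>2)"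
    and c: "0 \<le> c" "c * (max \<bar>a\<bar> \<bar>b\<bar>)\<^sup>2 \<le> \<kappa>"
  shows "hardy_gap c a b"
  unfolding hardy_gap_def
proof (intro allI impI, elim conjE)
  fix u u' assume u: "C1_on_line u u'" and ends: "u a = 0" "u b = 0"
  have "c * (LBINT x:{a<..<b}. x\<^sup>2 * (norm (u x))\<^sup>2) \<le> c * ((max \<bar>a\<bar> \<bar>b\<bar>)\<^sup>2 * (LBINT x:{a<..<b}. (norm (u x))\<^sup>2))"
    by (intro mult_left_mono LBINT_weight_le[OF u] c)
  also have "\<dots> \<le> \<kappa> * (LBINT x:{a<..<b}. (norm (u x))\<^sup>2)"
    unfolding mult.assoc[symmetric] by (intro mult_right_mono c LBINT_Ioo_nonneg) simp
  also have "\<dots> \<le> (LBINT x:{a<..<b}. (norm (u' x))\<^sup>2)"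
    by (rule le[OF u ends])
  finally show "c * (LBINT x:{a<..<b}. x\<^sup>2 * (norm (u x))\<^sup>2) \<le> (LBINT x:{a<..<b}. (norm (u' x))\<^sup>2)" .
qed

text \<open>The energy itself contains half of the weighted integral. Moving that half to the left
  turns \<open>2 * c\<close> into \<open>2 * c - 1\<close>, which still exceeds 1 when
  \<open>c\<close> does.\<close>

lemma hardy_gap_of_ground_state_energy:
  assumes ab: "a < b" and c: "0 \<le> c" "c * (max \<bar>a\<bar> \<bar>b\<bar>)\<^sup>2 \<le> ground_state_energy a b"
  shows "hardy_gap (2 * c - 1) a b"
  unfolding hardy_gap_def
proof (intro allI impI, elim conjE)
  fix u u' assume u: "C1_on_line u u'" and ends: "u a = 0" "u b = 0"
  let ?P = "LBINT x:{a<..<b}. x\<^sup>2 * (norm (u x))\<^sup>2"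
  have int: "set_integrable lborel {a<..<b} (\<lambda>x. (norm (u' x))\<^sup>2)"
    "set_integrable lborel {a<..<b} (\<lambda>x. x\<^sup>2 * (norm (u x))\<^sup>2)"
    by (intro set_integrable_Ioo_continuous continuous_intros C1_on_lineD[OF u])+
  have "c * ?P \<le> c * ((max \<bar>a\<bar> \<bar>b\<bar>)\<^sup>2 * (LBINT x:{a<..<b}. (norm (u x))\<^sup>2))"
    by (intro mult_left_mono LBINT_weight_le[OF u] c)
  also have "\<dots> \<le> ground_state_energy a b * (LBINT x:{a<..<b}. (norm (u x))\<^sup>2)"
    unfolding mult.assoc[symmetric] by (intro mult_right_mono c LBINT_Ioo_nonneg) simp
  also have "\<dots> \<le> 1/2 * (LBINT x:{a<..<b}. (norm (u' x))\<^sup>2 + x\<^sup>2 * (norm (u x))\<^sup>2)"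
    by (rule ground_state_energy_le[OF u ends ab])
  also have "\<dots> = 1/2 * ((LBINT x:{a<..<b}. (norm (u' x))\<^sup>2) + ?P)"
    using int by (simp add: set_integral_add)
  finally show "(2 * c - 1) * ?P \<le> (LBINT x:{a<..<b}. (norm (u' x))\<^sup>2)"
    by (simp add: algebra_simps)
qed

text \<open>
  Subtracting the affine interpolant does not increase \<open>\<integral> |w'|\<^sup>2\<close>, since its slope is the mean of \<open>w'\<close>.
\<close>

lemma hardy_gap_interpolate:
  assumes gap: "hardy_gap c a b" and ab: "a < b" and w: "C1_on_line w w'"
  shows "c * (LBINT x:{a<..<b}. x\<^sup>2 * (norm (w x - (w a + (x - a) *\<^sub>R ((w b - w a) /\<^sub>R (b - a)))))\<^sup>2)
    \<le> (LBINT x:{a<..<b}. (norm (w' x))\<^sup>2)"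
proof -
  define \<delta> where "\<delta> = (w b - w a) /\<^sub>R (b - a)"
  define v where "v x = w x - (w a + (x - a) *\<^sub>R \<delta>)" for x
  have diff: "w b - w a = (b - a) *\<^sub>R \<delta>"
    using ab by (simp add: \<delta>_def)
  have v: "C1_on_line v (\<lambda>x. w' x - \<delta>)"
    unfolding C1_on_line_def v_def
    by (auto intro!: derivative_eq_intros continuous_intros C1_on_lineD[OF w])
  have ends: "v a = 0" "v b = 0"
    by (simp_all add: v_def diff[symmetric])
  note cont = C1_on_lineD(3)[OF w, of "{a..b}"]
  have int: "set_integrable lborel {a<..<b} (\<lambda>x. (norm (w' x))\<^sup>2)" "set_integrable lborel {a<..<b} (\<lambda>x. w' x \<bullet> \<delta>)"
    "set_integrable lborel {a<..<b} (\<lambda>x. (norm \<delta>)\<^sup>2)"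
    by (intro set_integrable_Ioo_continuous continuous_intros cont)+
  have cross: "(LBINT x:{a<..<b}. w' x \<bullet> \<delta>) = (b - a) * (norm \<delta>)\<^sup>2"
  proof -
    have "(LBINT x:{a<..<b}. w' x \<bullet> \<delta>) = w b \<bullet> \<delta> - w a \<bullet> \<delta>"
      by (rule LBINT_Ioo_FTC)
         (use ab in \<open>auto intro!: continuous_intros cont
            bounded_linear.has_vector_derivative[OF bounded_linear_inner_left] C1_on_lineD(1)[OF w]\<close>)
    also have "\<dots> = (b - a) * (norm \<delta>)\<^sup>2"
      using diff by (simp add: power2_norm_eq_inner flip: inner_diff_left)
    finally show ?thesis .
  qed
  have const: "(LBINT x:{a<..<b}. (norm \<delta>)\<^sup>2) = (b - a) * (norm \<delta>)\<^sup>2"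
    using ab by (simp add: set_lebesgue_integral_def)
  have "c * (LBINT x:{a<..<b}. x\<^sup>2 * (norm (v x))\<^sup>2) \<le> (LBINT x:{a<..<b}. (norm (w' x - \<delta>))\<^sup>2)"
    using gap v ends unfolding hardy_gap_def by blast
  also have "\<dots> = (LBINT x:{a<..<b}. (norm (w' x))\<^sup>2 - 2 * (w' x \<bullet> \<delta>) + (norm \<delta>)\<^sup>2)"
    by (simp add: power2_norm_eq_inner inner_diff_left inner_diff_right inner_commute algebra_simps)
  also have "\<dots> = (LBINT x:{a<..<b}. (norm (w' x))\<^sup>2) - (b - a) * (norm \<delta>)\<^sup>2"
    using int by (simp add: set_integral_add set_integral_diff cross const)
  also have "\<dots> \<le> (LBINT x:{a<..<b}. (norm (w' x))\<^sup>2)"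
    using ab by simp
  finally show ?thesis unfolding v_def \<delta>_def .
qed

section \<open>Summation over the intervals\<close>

lemma set_integral_le_imp_nn_integral_le:
  fixes f g :: "real \<Rightarrow> real"
  assumes f: "set_integrable lborel A f" "\<And>x. 0 \<le> f x" and g: "set_integrable lborel A g" "\<And>x. 0 \<le> g x"
    and le: "(LBINT x:A. f x) \<le> (LBINT x:A. g x)"
  shows "(\<integral>\<^sup>+x. ennreal (f x) * indicator A x \<partial>lborel) \<le> (\<integral>\<^sup>+x. ennreal (g x) * indicator A x \<partial>lborel)"
proof -
  have "(\<integral>\<^sup>+x. ennreal (h x) * indicator A x \<partial>lborel) = ennreal (LBINT x:A. h x)"
    if "set_integrable lborel A h" "\<And>x. 0 \<le> h x" for h
  proof -
    have "(\<integral>\<^sup>+x. ennreal (h x) * indicator A x \<partial>lborel) = (\<integral>\<^sup>+x. ennreal (indicator A x *\<^sub>R h x) \<partial>lborel)"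
      by (intro nn_integral_cong) (auto split: split_indicator)
    also have "\<dots> = ennreal (LBINT x:A. h x)"
      using that unfolding set_lebesgue_integral_def set_integrable_def
      by (intro nn_integral_eq_integral) auto
    finally show ?thesis .
  qed
  thus ?thesis using assms by (simp add: ennreal_leI)
qed

text \<open>The index is the largest \<open>j\<close> with \<open>s j < x\<close>; divergence at
  both ends confines the search to the finite range \<open>{n..N}\<close>.\<close>

lemma decomposes_line_cover:
  assumes s: "decomposes_line s" and x: "x \<notin> range s"
  shows "\<exists>j. s j < x \<and> x < s (j + 1)"
proof -
  have mono: "strict_mono s" using s by (simp add: decomposes_line_def)
  have "eventually (\<lambda>j. x < s j) at_top" "eventually (\<lambda>j. s j < x) at_bot"
    using s by (auto simp: decomposes_line_def filterlim_at_top_dense filterlim_at_bot_dense)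
  then obtain N n where N: "x < s N" and n: "s n < x"
    by (auto simp: eventually_at_top_linorder eventually_at_bot_linorder)
  let ?J = "{j \<in> {n..N}. s j < x}"
  have "n \<le> N"
    using N n mono by (metis less_trans strict_mono_less_eq linear not_less order.strict_trans1)
  have J: "finite ?J" "n \<in> ?J"
    using n \<open>n \<le> N\<close> by (auto intro: finite_subset[of _ "{n..N}"])
  define j where "j = Max ?J"
  have j: "j \<in> ?J" unfolding j_def using J by (intro Max_in) auto
  hence "j \<noteq> N" using N by auto
  have "j + 1 \<notin> ?J"
  proof
    assume "j + 1 \<in> ?J"
    hence "j + 1 \<le> j" unfolding j_def by (intro Max_ge J) auto
    thus False by simp
  qed
  hence "x \<le> s (j + 1)" using j \<open>j \<noteq> N\<close> by auto
  moreover have "x \<noteq> s (j + 1)" using x by auto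
  ultimately show ?thesis using j by auto
qed

lemma decomposes_line_disjoint:
  assumes s: "decomposes_line s"
    and "s i < x" "x < s (i + 1)" "s j < x" "x < s (j + 1)"
  shows "i = j"
proof -
  have mono: "strict_mono s" using s by (simp add: decomposes_line_def)
  have "s i < s (j + 1)" "s j < s (i + 1)" using assms by auto
  thus ?thesis using mono by (simp add: strict_mono_less)
qed

lemma L2_on_AE_cong:
  assumes "f \<in> L2_on UNIV" and "AE x in lborel. f x = g x" and "g \<in> borel_measurable borel"
  shows "g \<in> L2_on UNIV"
proof -
  have "integrable lborel (\<lambda>x. (norm (g x))\<^sup>2) \<longleftrightarrow> integrable lborel (\<lambda>x. (norm (f x))\<^sup>2)"
    using assms L2_onD(1)[OF assms(1)]
    by (intro integrable_cong_AE) (auto elim!: eventually_mono)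
  thus ?thesis
    using assms L2_onD[OF assms(1)]
    unfolding L2_on_def set_borel_measurable_def set_integrable_def by simp
qed

text \<open>The relation between \<open>f\<close> and \<open>g\<close> is stated as the
  mollification identity, so that the lemma applies to \<open>g\<close> and the reflection of
  \<open>f\<close> as well. The mollification is removed after the summation, where one bound covers
  all intervals.\<close>

lemma hardy_inequality:
  assumes s: "decomposes_line s" and c: "0 \<le> c" and gap: "\<And>j. hardy_gap c (s j) (s (j + 1))"
    and f: "f \<in> L2_on UNIV" and g: "g \<in> L2_on UNIV"
    and fg: "\<And>\<sigma> x. \<sigma> > 0 \<Longrightarrow> mollify \<sigma> f x = expint (\<lambda>k. g k * complex_of_real (gauss \<sigma> k)) x"
    and fin: "(\<integral>\<^sup>+k. ennreal (k\<^sup>2 * (norm (g k))\<^sup>2) \<partial>lborel) < \<infinity>"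
    and zero: "vanishes_on f (range s)"
  shows "(\<integral>\<^sup>+x. ennreal (c * (x\<^sup>2 * (norm (f x))\<^sup>2)) \<partial>lborel) \<le> (\<integral>\<^sup>+k. ennreal (k\<^sup>2 * (norm (g k))\<^sup>2) \<partial>lborel)"
proof -
  let ?K = "\<integral>\<^sup>+k. ennreal (k\<^sup>2 * (norm (g k))\<^sup>2) \<partial>lborel"
  note [measurable] = L2_onD(1)[OF f] L2_onD(1)[OF g]
  from zero obtain f0 where cont: "continuous_on UNIV f0" and ae: "AE x in lborel. f x = f0 x"
    and f0_zero: "f0 (s j) = 0" for j
    unfolding vanishes_on_def by auto
  have [measurable]: "f0 \<in> borel_measurable borel"
    by (rule borel_measurable_continuous_onI[OF cont])
  have f0: "f0 \<in> L2_on UNIV"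
    by (rule L2_on_AE_cong[OF f ae]) simp
  define G where "G n k = g k * complex_of_real (gauss (1 / real (Suc n)) k)" for n k
  define w where "w n = expint (G n)" for n
  define w' where "w' n = expint (\<lambda>k. \<i> * (complex_of_real k * G n k))" for n
  \<comment> \<open>Convergence is needed at every point, not just almost everywhere: the endpoints
    form a null set, yet the limit has to vanish there.\<close>
  have w_lim: "(\<lambda>n. w n x) \<longlonglongrightarrow> f0 x" for x
  proof -
    have "mollify \<sigma> f0 x = mollify \<sigma> f x" for \<sigma>
      unfolding mollify_def using ae by (intro integral_cong_AE) (auto elim!: eventually_mono)
    moreover have "mollify (1 / real (Suc n)) f x = w n x" for n
      unfolding w_def G_def by (rule fg) simp
    ultimately show ?thesis using mollify_tendsto[OF f0 cont, of x] by simp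
  qed
  \<comment> \<open>The finite moment puts \<open>k * g k\<close> in L2, so its product with a
    Gaussian is integrable; this is what makes the mollifications C1.\<close>
  have kg: "(\<lambda>k. complex_of_real k * g k) \<in> L2_on UNIV"
    using fin unfolding L2_on_def set_borel_measurable_def set_integrable_def
    by (auto simp: norm_mult power_mult_distrib integrable_iff_bounded)
  have gauss: "(\<lambda>k. complex_of_real (gauss (1 / real (Suc n)) k)) \<in> L2_on UNIV" for n
    using gauss_L2[of "1 / real (Suc n)" 0] by simp
  have G_int: "integrable lborel (G n)" for n
    unfolding G_def by (rule integrable_mult_L2[OF g gauss])
  have kG_int: "integrable lborel (\<lambda>k. complex_of_real k * G n k)" for n
    using integrable_mult_L2[OF kg gauss[of n]] by (simp add: G_def mult_ac)
  have ikG_int: "integrable lborel (\<lambda>k. \<i> * (complex_of_real k * G n k))" for n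
    using kG_int[of n] by simp
  have C1: "C1_on_line (w n) (w' n)" for n
    unfolding C1_on_line_def w_def w'_def
    using expint_has_vector_derivative[OF G_int kG_int] continuous_expint[OF ikG_int] by blast
  have [measurable]: "w n \<in> borel_measurable borel" "w' n \<in> borel_measurable borel" for n
    using C1_on_lineD(2,3)[OF C1] by (auto intro: borel_measurable_continuous_onI)
  \<comment> \<open>As \<open>gauss\<close> is at most 1, the bound does not depend on
    \<open>n\<close>.\<close>
  have w'_le: "(\<integral>\<^sup>+x. ennreal ((norm (w' n x))\<^sup>2) \<partial>lborel) \<le> ?K" for n
  proof -
    have "(\<integral>\<^sup>+x. ennreal ((norm (w' n x))\<^sup>2) \<partial>lborel) \<le> (\<integral>\<^sup>+k. ennreal ((norm (\<i> * (complex_of_real k * G n k)))\<^sup>2) \<partial>lborel)"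
      unfolding w'_def by (rule plancherel_le[OF ikG_int])
    also have "\<dots> \<le> ?K"
    proof (intro nn_integral_mono ennreal_leI)
      fix k
      have "norm (\<i> * (complex_of_real k * G n k)) \<le> \<bar>k\<bar> * norm (g k)"
        using gauss_bounds[of "1 / real (Suc n)" k]
        by (simp add: G_def norm_mult mult_left_le mult_left_mono)
      hence "(norm (\<i> * (complex_of_real k * G n k)))\<^sup>2 \<le> (\<bar>k\<bar> * norm (g k))\<^sup>2"
        by (rule power_mono) simp
      thus "(norm (\<i> * (complex_of_real k * G n k)))\<^sup>2 \<le> k\<^sup>2 * (norm (g k))\<^sup>2"
        by (simp add: power_mult_distrib)
    qed
    finally show ?thesis .
  qed

  \<comment> \<open>The intervals are renumbered by natural numbers, over which the series and its
    exchange with the integral are stated.\<close>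
  define a b where "a i = s (int_decode i)" and "b i = s (int_decode i + 1)" for i
  define I where "I i = {a i<..<b i}" for i
  have ab: "a i < b i" for i
    using s by (simp add: a_def b_def decomposes_line_def strict_mono_less)
  have disj: "i = j" if "x \<in> I i" "x \<in> I j" for i j x
  proof -
    have "int_decode i = int_decode j"
      using decomposes_line_disjoint[OF s] that by (auto simp: I_def a_def b_def)
    thus ?thesis by (simp add: int_decode_eq)
  qed
  define v where "v n i x = w n x - (w n (a i) + (x - a i) *\<^sub>R ((w n (b i) - w n (a i)) /\<^sub>R (b i - a i)))" for n i x
  \<comment> \<open>At each point at most one summand is nonzero; the form of a series permits
    integration term by term.\<close>
  define V where "V n x = (\<Sum>i. ennreal (c * (x\<^sup>2 * (norm (v n i x))\<^sup>2)) * indicator (I i) x)" for n x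
  have [measurable]: "v n i \<in> borel_measurable borel" for n i
    unfolding v_def by measurable
  have [measurable]: "I i \<in> sets borel" for i
    unfolding I_def by simp
  have [measurable]: "V n \<in> borel_measurable lborel" for n
    unfolding V_def by measurable
  have single: "(\<Sum>i. h i * indicator (I i) x) = h j" if "x \<in> I j" for h :: "nat \<Rightarrow> ennreal" and x j
  proof -
    have "(\<Sum>i. h i * indicator (I i) x) = (\<Sum>i\<in>{j}. h i * indicator (I i) x)"
      using that disj by (intro suminf_finite) (auto simp: indicator_def)
    thus ?thesis using that by simp
  qed
  have V_le: "(\<integral>\<^sup>+x. V n x \<partial>lborel) \<le> ?K" for n
  proof -
    have "(\<integral>\<^sup>+x. V n x \<partial>lborel) = (\<Sum>i. \<integral>\<^sup>+x. ennreal (c * (x\<^sup>2 * (norm (v n i x))\<^sup>2)) * indicator (I i) x \<partial>lborel)"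
      unfolding V_def by (rule nn_integral_suminf) measurable
    also have "\<dots> \<le> (\<Sum>i. \<integral>\<^sup>+x. ennreal ((norm (w' n x))\<^sup>2) * indicator (I i) x \<partial>lborel)"
    proof (intro suminf_le)
      fix i
      note cont_w = C1_on_lineD(2,3)[OF C1[of n], of "{a i..b i}"]
      have "c * (LBINT x:I i. x\<^sup>2 * (norm (v n i x))\<^sup>2) \<le> (LBINT x:I i. (norm (w' n x))\<^sup>2)"
        unfolding I_def v_def
        by (rule hardy_gap_interpolate[OF _ ab C1]) (unfold a_def b_def, rule gap)
      hence "(LBINT x:I i. c * (x\<^sup>2 * (norm (v n i x))\<^sup>2)) \<le> (LBINT x:I i. (norm (w' n x))\<^sup>2)"
        by simp
      thus "(\<integral>\<^sup>+x. ennreal (c * (x\<^sup>2 * (norm (v n i x))\<^sup>2)) * indicator (I i) x \<partial>lborel)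
          \<le> (\<integral>\<^sup>+x. ennreal ((norm (w' n x))\<^sup>2) * indicator (I i) x \<partial>lborel)"
        using c unfolding I_def
        by (intro set_integral_le_imp_nn_integral_le set_integrable_Ioo_continuous)
           (auto simp: v_def intro!: continuous_intros cont_w)
    qed auto
    also have "\<dots> = (\<integral>\<^sup>+x. (\<Sum>i. ennreal ((norm (w' n x))\<^sup>2) * indicator (I i) x) \<partial>lborel)"
      by (rule nn_integral_suminf[symmetric]) measurable
    also have "\<dots> \<le> (\<integral>\<^sup>+x. ennreal ((norm (w' n x))\<^sup>2) \<partial>lborel)"
    proof (rule nn_integral_mono)
      fix x
      show "(\<Sum>i. ennreal ((norm (w' n x))\<^sup>2) * indicator (I i) x) \<le> ennreal ((norm (w' n x))\<^sup>2)"
      proof (cases "\<exists>j. x \<in> I j")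
        case True
        then obtain j where "x \<in> I j" ..
        from single[OF this, of "\<lambda>_. ennreal ((norm (w' n x))\<^sup>2)"] show ?thesis by simp
      next
        case False
        thus ?thesis by simp
      qed
    qed
    also have "\<dots> \<le> ?K" by (rule w'_le)
    finally show ?thesis .
  qed
  have "(\<integral>\<^sup>+x. ennreal (c * (x\<^sup>2 * (norm (f0 x))\<^sup>2)) \<partial>lborel) \<le> ?K"
  proof (rule nn_integral_le_of_tendsto[OF _ _ V_le])
    have "AE x in lborel. x \<notin> range s"
      by (intro AE_not_in countable_imp_null_set_lborel) auto
    thus "AE x in lborel. (\<lambda>n. V n x) \<longlonglongrightarrow> ennreal (c * (x\<^sup>2 * (norm (f0 x))\<^sup>2))"
    proof (rule eventually_mono)
      fix x assume "x \<notin> range s"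
      then obtain j0 where "s j0 < x" "x < s (j0 + 1)"
        using decomposes_line_cover[OF s] by blast
      hence x: "x \<in> I (int_encode j0)" by (simp add: I_def a_def b_def)
      define j where "j = int_encode j0"
      \<comment> \<open>The affine correction converges to the interpolant of \<open>f0\<close>,
        which is 0 because \<open>f0\<close> vanishes at both ends.\<close>
      have "(\<lambda>n. v n j x) \<longlonglongrightarrow> f0 x - (f0 (a j) + (x - a j) *\<^sub>R ((f0 (b j) - f0 (a j)) /\<^sub>R (b j - a j)))"
        unfolding v_def by (intro tendsto_intros w_lim)
      hence "(\<lambda>n. v n j x) \<longlonglongrightarrow> f0 x"
        by (simp add: a_def b_def f0_zero)
      hence "(\<lambda>n. ennreal (c * (x\<^sup>2 * (norm (v n j x))\<^sup>2))) \<longlonglongrightarrow> ennreal (c * (x\<^sup>2 * (norm (f0 x))\<^sup>2))"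
        by (intro tendsto_intros tendsto_ennrealI)
      thus "(\<lambda>n. V n x) \<longlonglongrightarrow> ennreal (c * (x\<^sup>2 * (norm (f0 x))\<^sup>2))"
        using x unfolding V_def j_def by (simp add: single)
    qed
  qed simp
  moreover have "(\<integral>\<^sup>+x. ennreal (c * (x\<^sup>2 * (norm (f x))\<^sup>2)) \<partial>lborel) = (\<integral>\<^sup>+x. ennreal (c * (x\<^sup>2 * (norm (f0 x))\<^sup>2)) \<partial>lborel)"
    using ae by (intro nn_integral_cong_AE) (auto elim!: eventually_mono)
  ultimately show ?thesis by simp
qed

section \<open>From each supercriticality condition to one constant for all intervals\<close>

lemma max_abs_pos:
  assumes "decomposes_line s"
  shows "max_abs s j > 0"
proof -
  have "s j < s (j + 1)" using assms by (simp add: decomposes_line_def strict_mono_less)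
  thus ?thesis unfolding max_abs_def by auto
qed

text \<open>\<open>sqrt\<close> of a negative real is negative here, so the strict lower bound
  forces \<open>E > 0\<close>, and squaring is legitimate.\<close>

lemma square_mult_le_of_less_sqrt_div:
  assumes "M > 0" "0 \<le> q" "q < sqrt E / M"
  shows "q\<^sup>2 * M\<^sup>2 \<le> E"
proof -
  have le: "q * M < sqrt E" using assms by (simp add: field_simps)
  hence "0 < sqrt E" using assms by (meson le_less_trans mult_nonneg_nonneg less_imp_le)
  hence E: "0 < E" by simp
  have "(q * M)\<^sup>2 \<le> (sqrt E)\<^sup>2" using le assms by (intro power_mono) auto
  thus ?thesis using E by (simp add: power_mult_distrib)
qed

text \<open>On an interval of length \<open>d\<close>, Wirtinger is used with
  \<open>\<omega> = p / d\<close>. For the larger endpoint modulus \<open>M\<close>, the bound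
  \<open>M * d < q\<close> gives \<open>(p / q) * M <= p / d\<close>, hence the constant
  \<open>(p / q)^2\<close>.\<close>

lemma hardy_gap_supercritical:
  assumes s: "decomposes_line s" and sup: "(SUP j. ereal (max_abs s j * (s (j + 1) - s j))) < ereal pi"
  shows "\<exists>c>1. \<forall>j. hardy_gap c (s j) (s (j + 1))"
proof -
  obtain q where q: "(SUP j. ereal (max_abs s j * (s (j + 1) - s j))) < ereal q" "q < pi"
    using ereal_dense2[OF sup] by auto
  have lt: "max_abs s j * (s (j + 1) - s j) < q" for j
    using SUP_lessD[OF q(1), of j] by simp
  have ab: "s j < s (j + 1)" for j
    using s by (simp add: decomposes_line_def strict_mono_less)
  have q0: "q > 0"
    using lt[of 0] max_abs_pos[OF s, of 0] ab[of 0] by (smt (verit) mult_pos_pos)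
  \<comment> \<open>Strictly above \<open>q\<close> to make the constant exceed 1, strictly below
    \<open>pi\<close> to keep the tangent in \<open>wirtinger_inequality\<close> regular.\<close>
  define p where "p = (q + pi) / 2"
  have p: "q < p" "p < pi" using q by (auto simp: p_def)
  have "hardy_gap ((p / q)\<^sup>2) (s j) (s (j + 1))" for j
  proof (rule hardy_gap_of_dirichlet_bound)
    let ?d = "s (j + 1) - s j"
    fix u u' assume "C1_on_line u u'" "u (s j) = 0" "u (s (j + 1)) = 0"
    thus "(p / ?d)\<^sup>2 * (LBINT x:{s j<..<s (j + 1)}. (norm (u x))\<^sup>2) \<le> (LBINT x:{s j<..<s (j + 1)}. (norm (u' x))\<^sup>2)"
      using ab[of j] p q0 by (intro wirtinger_inequality) auto
  next
    let ?d = "s (j + 1) - s j"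
    have "p * (max_abs s j * ?d) \<le> p * q"
      using lt[of j] p q0 by (intro mult_left_mono) auto
    hence "p / q * max_abs s j \<le> p / ?d"
      using ab[of j] q0 by (simp add: divide_simps mult_ac)
    hence "(p / q * max_abs s j)\<^sup>2 \<le> (p / ?d)\<^sup>2"
      using p q0 max_abs_pos[OF s, of j] by (intro power_mono) auto
    thus "(p / q)\<^sup>2 * (max \<bar>s j\<bar> \<bar>s (j + 1)\<bar>)\<^sup>2 \<le> (p / ?d)\<^sup>2"
      unfolding max_abs_def power_mult_distrib .
  qed simp
  moreover have "(p / q)\<^sup>2 > 1" using p q0 by (intro one_less_power) auto
  ultimately show ?thesis by blast
qed

text \<open>A real \<open>q\<close> strictly between 1 and the infimum holds the uniform margin; the
  constant is its square because the eigenvalue enters through its root.\<close>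

lemma hardy_gap_supercritical_spectrum:
  assumes s: "decomposes_line s"
    and inf: "(INF j. ereal (sqrt (sturm_liouville_eigenvalue (s j) (s (j + 1))) / max_abs s j)) > 1"
  shows "\<exists>c>1. \<forall>j. hardy_gap c (s j) (s (j + 1))"
proof -
  obtain q where q: "1 < ereal q" "ereal q < (INF j. ereal (sqrt (sturm_liouville_eigenvalue (s j) (s (j + 1))) / max_abs s j))"
    using ereal_dense2[OF inf] by auto
  hence q1: "q > 1" by simp
  have "hardy_gap (q\<^sup>2) (s j) (s (j + 1))" for j
  proof (rule hardy_gap_of_dirichlet_bound[OF sturm_liouville_eigenvalue_le])
    show "s j < s (j + 1)"
      using s by (simp add: decomposes_line_def strict_mono_less)
    have "q\<^sup>2 * (max_abs s j)\<^sup>2 \<le> sturm_liouville_eigenvalue (s j) (s (j + 1))"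
      using less_INF_D[OF q(2), of j] q1 max_abs_pos[OF s, of j] by (intro square_mult_le_of_less_sqrt_div) auto
    thus "q\<^sup>2 * (max \<bar>s j\<bar> \<bar>s (j + 1)\<bar>)\<^sup>2 \<le> sturm_liouville_eigenvalue (s j) (s (j + 1))"
      by (simp add: max_abs_def)
  qed simp_all
  moreover have "q\<^sup>2 > 1" using q1 by (intro one_less_power) auto
  ultimately show ?thesis by blast
qed

lemma hardy_gap_supercritical_energy:
  assumes s: "decomposes_line s"
    and inf: "(INF j. ereal (sqrt (ground_state_energy (s j) (s (j + 1))) / max_abs s j)) > 1"
  shows "\<exists>c>1. \<forall>j. hardy_gap c (s j) (s (j + 1))"
proof -
  obtain q where q: "1 < ereal q" "ereal q < (INF j. ereal (sqrt (ground_state_energy (s j) (s (j + 1))) / max_abs s j))"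
    using ereal_dense2[OF inf] by auto
  hence q1: "q > 1" by simp
  have "hardy_gap (2 * q\<^sup>2 - 1) (s j) (s (j + 1))" for j
  proof (rule hardy_gap_of_ground_state_energy)
    show "s j < s (j + 1)"
      using s by (simp add: decomposes_line_def strict_mono_less)
    have "q\<^sup>2 * (max_abs s j)\<^sup>2 \<le> ground_state_energy (s j) (s (j + 1))"
      using less_INF_D[OF q(2), of j] q1 max_abs_pos[OF s, of j] by (intro square_mult_le_of_less_sqrt_div) auto
    thus "q\<^sup>2 * (max \<bar>s j\<bar> \<bar>s (j + 1)\<bar>)\<^sup>2 \<le> ground_state_energy (s j) (s (j + 1))"
      by (simp add: max_abs_def)
  qed simp_all
  moreover have "q\<^sup>2 > 1" using q1 by (intro one_less_power) auto
  hence "2 * q\<^sup>2 - 1 > 1" by simp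
  ultimately show ?thesis by blast
qed

section \<open>Uniqueness from the zeros of a function and of its transform\<close>

lemma has_fourier_transform_zero:
  assumes f: "f \<in> L2_on UNIV" and ae: "AE x in lborel. f x = 0"
  shows "has_fourier_transform f (\<lambda>_. 0)"
proof -
  have "vderiv (\<lambda>_. 0) = (\<lambda>_. 0)"
    by (simp add: vderiv_def fun_eq_iff)
  hence "(vderiv ^^ n) (\<lambda>_. 0) = (\<lambda>_. 0)" for n
    by (induction n) simp_all
  hence "schwartz (\<lambda>_. 0)"
    by (simp add: schwartz_def smooth_def)
  moreover have "(\<integral>\<^sup>+x. ennreal ((norm (0 - f x))\<^sup>2) \<partial>lborel) = (\<integral>\<^sup>+x. 0 \<partial>(lborel :: real measure))"
    using ae by (intro nn_integral_cong_AE) (auto elim!: eventually_mono)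
  hence "L2_tendsto (\<lambda>_ _. 0) f"
    by (simp add: L2_tendsto_def)
  moreover have "L2_tendsto (\<lambda>n. fourier_integral (\<lambda>_. 0)) (\<lambda>_. 0)"
    by (simp add: L2_tendsto_def fourier_integral_def)
  moreover have "(\<lambda>_. 0) \<in> L2_on UNIV"
    by (simp add: L2_on_def set_borel_measurable_def set_integrable_def)
  ultimately show ?thesis
    unfolding has_fourier_transform_def using f by (intro conjI exI[of _ "\<lambda>_ _. 0"] allI)
qed

theorem theorem2p5:
  fixes l m :: "int \<Rightarrow> real" and f :: "real \<Rightarrow> complex"
  assumes "decomposes_line l" and "decomposes_line m"
    and "uniformly_supercritical l m \<or> uniformly_supercritical_energy l m \<or>
         uniformly_supercritical_spectrum l m"
    and "f \<in> fourier_sobolev"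
  shows "(vanishes_on f (range l) \<and> (\<exists>g. has_fourier_transform f g \<and> vanishes_on g (range m)))
           \<longleftrightarrow> (AE x in lborel. f x = 0)"
proof
  assume "vanishes_on f (range l) \<and> (\<exists>g. has_fourier_transform f g \<and> vanishes_on g (range m))"
  then obtain g where fl: "vanishes_on f (range l)" and fg: "has_fourier_transform f g"
    and gm: "vanishes_on g (range m)" by blast
  have f: "f \<in> L2_on UNIV" and g: "g \<in> L2_on UNIV"
    using fg by (auto simp: has_fourier_transform_def)
  note [measurable] = L2_onD(1)[OF f] L2_onD(1)[OF g]
  let ?A = "\<integral>\<^sup>+x. ennreal (x\<^sup>2 * (norm (f x))\<^sup>2) \<partial>lborel"
  let ?B = "\<integral>\<^sup>+k. ennreal (k\<^sup>2 * (norm (g k))\<^sup>2) \<partial>lborel"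
  \<comment> \<open>Membership in the space only yields some representative \<open>h\<close> with
    finite moment; uniqueness of the transform carries the bound over to \<open>g\<close>.\<close>
  obtain h where fh: "has_fourier_transform f h"
    and fin: "?A + (\<integral>\<^sup>+k. ennreal (k\<^sup>2 * (norm (h k))\<^sup>2) \<partial>lborel) < \<infinity>"
    using assms(4) unfolding fourier_sobolev_def by blast
  have "(\<integral>\<^sup>+k. ennreal (k\<^sup>2 * (norm (h k))\<^sup>2) \<partial>lborel) = ?B"
    using fourier_transform_unique[OF fh fg] by (intro nn_integral_cong_AE) (auto elim!: eventually_mono)
  with fin have A: "?A < \<infinity>" and B: "?B < \<infinity>" by auto
  have gap: "\<exists>c>1. \<forall>j. hardy_gap c (s j) (s (j + 1))" if s: "decomposes_line s" "s = l \<or> s = m" for s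
    using assms(3)
  proof (elim disjE)
    assume "uniformly_supercritical l m"
    with s show ?thesis
      by (intro hardy_gap_supercritical) (auto simp: uniformly_supercritical_def)
  next
    assume "uniformly_supercritical_energy l m"
    with s show ?thesis
      by (intro hardy_gap_supercritical_energy) (auto simp: uniformly_supercritical_energy_def)
  next
    assume "uniformly_supercritical_spectrum l m"
    with s show ?thesis
      by (intro hardy_gap_supercritical_spectrum) (auto simp: uniformly_supercritical_spectrum_def)
  qed
  obtain c where c: "c > 1" "\<And>j. hardy_gap c (l j) (l (j + 1))"
    using gap[OF assms(1)] by blast
  obtain d where d: "d > 1" "\<And>j. hardy_gap d (m j) (m (j + 1))"
    using gap[OF assms(2)] by blast
  have cA: "(\<integral>\<^sup>+x. ennreal (c * (x\<^sup>2 * (norm (f x))\<^sup>2)) \<partial>lborel) \<le> ?B"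
    by (rule hardy_inequality[OF assms(1) _ c(2) f g fourier_transform_mollify(1)[OF fg] B fl])
       (use c in auto)
  have reflect: "(\<integral>\<^sup>+x. ennreal (x\<^sup>2 * (norm (f (- x)))\<^sup>2) \<partial>lborel) = ?A"
    using nn_integral_reflect[of "\<lambda>x. ennreal (x\<^sup>2 * (norm (f x))\<^sup>2)"] by simp
  \<comment> \<open>The roles are exchanged: the reflection of \<open>f\<close> acts as the
    transform of \<open>g\<close>, and \<open>reflect\<close> undoes the sign in its moment.\<close>
  have dB: "(\<integral>\<^sup>+k. ennreal (d * (k\<^sup>2 * (norm (g k))\<^sup>2)) \<partial>lborel) \<le> ?A"
    unfolding reflect[symmetric]
  proof (rule hardy_inequality[OF assms(2) _ d(2) g _ _ _ gm])
    show "(\<lambda>x. f (- x)) \<in> L2_on UNIV"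
      using f lborel_integrable_real_affine[OF L2_onD(2)[OF f], of "-1" 0]
      unfolding L2_on_def set_borel_measurable_def set_integrable_def by simp
    show "mollify \<sigma> g x = expint (\<lambda>k. f (- k) * complex_of_real (gauss \<sigma> k)) x" if "\<sigma> > 0" for \<sigma> x
      unfolding fourier_transform_mollify(2)[OF fg that] expint_def
      by (subst lborel_integral_real_affine[where c="-1" and t=0]) (simp_all add: gauss_def)
  qed (use d A reflect in auto)
  have "ennreal d * ?B \<le> ?A"
    using dB d by (simp add: ennreal_mult nn_integral_cmult)
  moreover have "ennreal c * ?A \<le> ?B"
    using cA c by (simp add: ennreal_mult nn_integral_cmult)
  moreover obtain A' where A': "?A = ennreal A'" "A' \<ge> 0"
    using A by (cases "?A") auto
  moreover obtain B' where B': "?B = ennreal B'" "B' \<ge> 0"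
    using B by (cases "?B") auto
  ultimately have "d * B' \<le> A'" "c * A' \<le> B'"
    using c d by (simp_all flip: ennreal_mult)
  \<comment> \<open>Chaining gives \<open>c * d * A' <= A'\<close> with \<open>c * d > 1\<close>,
    where \<open>A'\<close> is a finite nonnegative number.\<close>
  hence "A' = 0"
    using A' B' c d by (smt (verit) mult_less_cancel_right1 mult_le_cancel_right1)
  hence "AE x in lborel. ennreal (x\<^sup>2 * (norm (f x))\<^sup>2) = 0"
    using A' by (subst nn_integral_0_iff_AE[symmetric]) auto
  \<comment> \<open>The weight \<open>x^2\<close> says nothing about \<open>f\<close> at the origin,
    which is a null set.\<close>
  moreover have "AE x in lborel. x \<noteq> (0 :: real)"
    by (rule AE_lborel_singleton)
  ultimately show "AE x in lborel. f x = 0"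
    by eventually_elim auto
next
  assume ae: "AE x in lborel. f x = 0"
  have f: "f \<in> L2_on UNIV" using assms(4) by (simp add: fourier_sobolev_def)
  have "vanishes_on f (range l)" "vanishes_on (\<lambda>_. 0) (range m)"
    unfolding vanishes_on_def using ae by (intro exI[of _ "\<lambda>_. 0"]; auto)+
  thus "vanishes_on f (range l) \<and> (\<exists>g. has_fourier_transform f g \<and> vanishes_on g (range m))"
    using has_fourier_transform_zero[OF f ae] by blast
qed

end
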